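(* There exists an $O(n^3)$-time algorithm that, given a graphic sequence $d=(d_1,\ldots,d_n)$, constructs a graph realizing $d$ that has a matching of maximum size among all realizations of $d$ (i.e., of size $\textsc{MM}(d)$).
   Context: A sequence $d=(d_1,\ldots,d_n)$ is a non-increasing sequence of positive integers. A simple undirected graph $G$ on vertices $1,\ldots,n$ realizes $d$ if $\deg_G(i)=d_i$ for all $i$; $d$ is graphic if some graph realizes it. A matching is a set of pairwise vertex-disjoint edges; $\textsc{MM}(d)$ is the maximum, over all realizations $G$ of $d$, of the maximum size of a matching in $G$. *)

theory Defs
  imports "HOL-Library.Landau_Symbols"
begin

section \<open>Degree sequences, realizations and matchings\<close>

text \<open>
  A graph on \<open>n\<close> vertices is given by its set of edges, which are two-element subsets of the
  vertex set \<open>{0, \<dots>, n - 1}\<close>; vertex \<open>i\<close> carries the list entry \<open>d ! i\<close>.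
\<close>

definition simple_graph :: "nat \<Rightarrow> nat set set \<Rightarrow> bool" where
  "simple_graph n E \<longleftrightarrow> (\<forall>e\<in>E. e \<subseteq> {..<n} \<and> card e = 2)"

definition degree :: "nat set set \<Rightarrow> nat \<Rightarrow> nat" where
  "degree E v = card {e \<in> E. v \<in> e}"

definition realizes :: "nat list \<Rightarrow> nat set set \<Rightarrow> bool" where
  "realizes d E \<longleftrightarrow> simple_graph (length d) E \<and> (\<forall>i<length d. degree E i = d ! i)"

definition graphic :: "nat list \<Rightarrow> bool" where
  "graphic d \<longleftrightarrow> sorted_wrt (\<ge>) d \<and> (\<forall>x\<in>set d. x > 0) \<and> (\<exists>E. realizes d E)"

definition matching :: "nat set set \<Rightarrow> nat set set \<Rightarrow> bool" where
  "matching E M \<longleftrightarrow> M \<subseteq> E \<and> pairwise disjnt M"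

definition matching_number :: "nat set set \<Rightarrow> nat" where
  "matching_number E = Max {card M | M. matching E M}"

definition MM :: "nat list \<Rightarrow> nat" where
  "MM d = Max {matching_number E | E. realizes d E}"


section \<open>Algorithms and their running time\<close>

text \<open>
  Algorithms are structured programs for a unit-cost word RAM. A program uses finitely many scalar
  variables and finitely many arrays, all holding natural numbers. Every constant, variable
  access, array access, arithmetic operation, comparison and Boolean operation takes one time
  step, and so does every assignment and every conditional or loop branch.
  All numbers that occur, including intermediate results and array indices, must be smaller than
  a bound \<open>W\<close> (i.e. fit into one machine word); otherwise the program gets stuck and has no
  terminating execution. Subtraction is truncated at 0 and division by 0 yields 0.
\<close>

datatype aexp =
    Const nat
  | Var string
  | Elem string aexp
  | Plus aexp aexp
  | Minus aexp aexp
  | Times aexp aexp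
  | Div aexp aexp

datatype bexp =
    Less aexp aexp
  | Eq aexp aexp
  | BNot bexp
  | BAnd bexp bexp

datatype com =
    Skip
  | Assign string aexp
  | Store string aexp aexp
  | Seq com com
  | Cond bexp com com
  | While bexp com

record state =
  var :: "string \<Rightarrow> nat"
  arr :: "string \<Rightarrow> nat \<Rightarrow> nat"

fun aval :: "aexp \<Rightarrow> state \<Rightarrow> nat" where
  "aval (Const c) s = c"
| "aval (Var x) s = var s x"
| "aval (Elem A a) s = arr s A (aval a s)"
| "aval (Plus a b) s = aval a s + aval b s"
| "aval (Minus a b) s = aval a s - aval b s"
| "aval (Times a b) s = aval a s * aval b s"
| "aval (Div a b) s = aval a s div aval b s"

fun bval :: "bexp \<Rightarrow> state \<Rightarrow> bool" where
  "bval (Less a b) s \<longleftrightarrow> aval a s < aval b s"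
| "bval (Eq a b) s \<longleftrightarrow> aval a s = aval b s"
| "bval (BNot b) s \<longleftrightarrow> \<not> bval b s"
| "bval (BAnd b c) s \<longleftrightarrow> bval b s \<and> bval c s"

text \<open>No evaluation of a subexpression overflows.\<close>

fun afits :: "nat \<Rightarrow> aexp \<Rightarrow> state \<Rightarrow> bool" where
  "afits W (Const c) s \<longleftrightarrow> c < W"
| "afits W (Var x) s \<longleftrightarrow> var s x < W"
| "afits W (Elem A a) s \<longleftrightarrow> afits W a s \<and> arr s A (aval a s) < W"
| "afits W (Plus a b) s \<longleftrightarrow> afits W a s \<and> afits W b s \<and> aval a s + aval b s < W"
| "afits W (Minus a b) s \<longleftrightarrow> afits W a s \<and> afits W b s"
| "afits W (Times a b) s \<longleftrightarrow> afits W a s \<and> afits W b s \<and> aval a s * aval b s < W"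
| "afits W (Div a b) s \<longleftrightarrow> afits W a s \<and> afits W b s"

fun bfits :: "nat \<Rightarrow> bexp \<Rightarrow> state \<Rightarrow> bool" where
  "bfits W (Less a b) s \<longleftrightarrow> afits W a s \<and> afits W b s"
| "bfits W (Eq a b) s \<longleftrightarrow> afits W a s \<and> afits W b s"
| "bfits W (BNot b) s \<longleftrightarrow> bfits W b s"
| "bfits W (BAnd b c) s \<longleftrightarrow> bfits W b s \<and> bfits W c s"

fun acost :: "aexp \<Rightarrow> nat" where
  "acost (Const c) = 1"
| "acost (Var x) = 1"
| "acost (Elem A a) = acost a + 1"
| "acost (Plus a b) = acost a + acost b + 1"
| "acost (Minus a b) = acost a + acost b + 1"
| "acost (Times a b) = acost a + acost b + 1"
| "acost (Div a b) = acost a + acost b + 1"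

fun bcost :: "bexp \<Rightarrow> nat" where
  "bcost (Less a b) = acost a + acost b + 1"
| "bcost (Eq a b) = acost a + acost b + 1"
| "bcost (BNot b) = bcost b + 1"
| "bcost (BAnd b c) = bcost b + bcost c + 1"

text \<open>
  \<open>exec W P s t s'\<close>: with word bound \<open>W\<close>, program \<open>P\<close> started in state \<open>s\<close> terminates after
  exactly \<open>t\<close> time steps in state \<open>s'\<close>.
\<close>

inductive exec :: "nat \<Rightarrow> com \<Rightarrow> state \<Rightarrow> nat \<Rightarrow> state \<Rightarrow> bool" for W :: nat where
  Skip: "exec W Skip s 1 s"
| Assign: "afits W a s \<Longrightarrow>
    exec W (Assign x a) s (acost a + 1) (s\<lparr>var := (var s)(x := aval a s)\<rparr>)"
| Store: "afits W i s \<Longrightarrow> afits W a s \<Longrightarrow>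
    exec W (Store A i a) s (acost i + acost a + 1)
      (s\<lparr>arr := (arr s)(A := (arr s A)(aval i s := aval a s))\<rparr>)"
| Seq: "exec W P s t s' \<Longrightarrow> exec W Q s' u s'' \<Longrightarrow> exec W (Seq P Q) s (t + u) s''"
| CondTrue: "bfits W b s \<Longrightarrow> bval b s \<Longrightarrow> exec W P s t s' \<Longrightarrow>
    exec W (Cond b P Q) s (bcost b + 1 + t) s'"
| CondFalse: "bfits W b s \<Longrightarrow> \<not> bval b s \<Longrightarrow> exec W Q s t s' \<Longrightarrow>
    exec W (Cond b P Q) s (bcost b + 1 + t) s'"
| WhileFalse: "bfits W b s \<Longrightarrow> \<not> bval b s \<Longrightarrow> exec W (While b P) s (bcost b + 1) s"
| WhileTrue: "bfits W b s \<Longrightarrow> bval b s \<Longrightarrow> exec W P s t s' \<Longrightarrow>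
    exec W (While b P) s' u s'' \<Longrightarrow> exec W (While b P) s (bcost b + 1 + t + u) s''"

text \<open>Programs are deterministic, so one may speak of the execution on a given input.\<close>

lemma exec_deterministic:
  "exec W P s t s' \<Longrightarrow> exec W P s u s'' \<Longrightarrow> t = u \<and> s' = s''"
proof (induction arbitrary: u s'' rule: exec.induct)
  case (Skip s)
  then show ?case by cases simp
next
  case (Assign a s x)
  from Assign.prems show ?case by cases simp
next
  case (Store i s a A)
  from Store.prems show ?case by cases simp
next
  case (Seq P s t s1 Q v s2)
  from Seq.prems obtain t' s1' v' where
    *: "exec W P s t' s1'" "exec W Q s1' v' s''" "u = t' + v'"
    by cases
  from Seq.IH(1)[OF *(1)] Seq.IH(2)[of v' s''] * show ?case by simp
next
  case (CondTrue b s P t s1 Q)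
  from CondTrue.prems CondTrue.hyps(2) obtain t' where
    *: "exec W P s t' s''" "u = bcost b + 1 + t'"
    by cases simp_all
  from CondTrue.IH[OF *(1)] *(2) show ?case by simp
next
  case (CondFalse b s Q t s1 P)
  from CondFalse.prems CondFalse.hyps(2) obtain t' where
    *: "exec W Q s t' s''" "u = bcost b + 1 + t'"
    by cases simp_all
  from CondFalse.IH[OF *(1)] *(2) show ?case by simp
next
  case (WhileFalse b s P)
  from WhileFalse.prems WhileFalse.hyps(2) show ?case by cases simp_all
next
  case (WhileTrue b s P t s1 v s2)
  from WhileTrue.prems WhileTrue.hyps(2) obtain t' s1' v' where
    *: "exec W P s t' s1'" "exec W (While b P) s1' v' s''" "u = bcost b + 1 + t' + v'"
    by cases simp_all
  from WhileTrue.IH(1)[OF *(1)] WhileTrue.IH(2)[of v' s''] * show ?case by simp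
qed


section \<open>Input and output\<close>

text \<open>
  The variable \<open>n\<close> holds the length of the sequence and the array \<open>d\<close> its entries; all other
  memory cells are initially 0.
\<close>

definition input_state :: "nat list \<Rightarrow> state" where
  "input_state d =
    \<lparr>var = (\<lambda>x. if x = ''n'' then length d else 0),
     arr = (\<lambda>A i. if A = ''d'' \<and> i < length d then d ! i else 0)\<rparr>"

text \<open>The array \<open>adj\<close> holds the adjacency matrix of the graph, stored row by row.\<close>

definition outputs_graph :: "nat \<Rightarrow> state \<Rightarrow> nat set set \<Rightarrow> bool" where
  "outputs_graph n s E \<longleftrightarrow>
    (\<forall>i<n. \<forall>j<n. arr s ''adj'' (i * n + j) = (if {i, j} \<in> E then 1 else 0))"

end

theory Submission
  imports Defs
begin

text \<open>
  Degree-preserving edge switches show that if some realization has a matching of size \<open>m\<close>, then some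
  realization has a matching that covers exactly the first \<open>2 * m\<close> vertices. Moreover, among the
  vertices to be matched, one of maximal and one of minimal residual degree can be assumed to be
  mates, and a vertex \<open>v\<close> can be assumed to be adjacent to its mate and otherwise to the vertices of
  largest residual degree. Hence, for fixed \<open>m\<close>, a variant of the Havel-Hakimi procedure that lays off
  \<open>0, 1, \<dots>\<close> in turn and matches \<open>i\<close> with \<open>2 * m - 1 - i\<close> finds a suitable realization whenever one
  exists. With bucket counting instead of sorting, laying off one vertex takes time \<open>O(n)\<close>, so one
  attempt takes time \<open>O(n\<^sup>2)\<close>; trying all \<open>m\<close> downwards from \<open>n div 2\<close> gives \<open>O(n\<^sup>3)\<close>.
\<close>

section \<open>Edge switches\<close>

text \<open>The obstacle is that the classical Havel-Hakimi exchange, which trades a neighbour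
  \<open>y\<close> of the laid-off vertex for a vertex \<open>x\<close> of at least the same
  residual degree, also deletes an edge at \<open>x\<close>, and this may be the matching edge of
  \<open>x\<close>. Counting neighbours shows that this is unavoidable only if the two degrees are
  equal and the mate of \<open>x\<close> is the only neighbour that \<open>x\<close> can spare. Then
  \<open>x\<close> and \<open>y\<close> can trade mates, provided that \<open>y\<close> has one; the
  selection order is designed around this proviso. Pairing the two extremes makes the matching
  explicit: the part still to be matched is always the interval from \<open>v\<close> to
  \<open>2 * m - 1 - v\<close>, and if the residual degrees on it are non-increasing, its two ends
  are the next pair. No matching is stored and nothing is sorted again. Correctness is asymmetric. A
  run that ends without failure certifies itself, since vanishing residual degrees and adjacent
  mates have been tested. That a run cannot fail for a feasible \<open>m\<close> is an induction in
  which a hypothetical solution is brought into agreement with each greedy choice.\<close>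

definition graph_on :: "nat set \<Rightarrow> nat set set \<Rightarrow> bool" where
  "graph_on V E \<longleftrightarrow> (\<forall>e\<in>E. e \<subseteq> V \<and> card e = 2)"

definition nbrs :: "nat set set \<Rightarrow> nat \<Rightarrow> nat set" where
  "nbrs E v = {u. {v, u} \<in> E}"

lemma graph_on_finite: "finite V \<Longrightarrow> graph_on V E \<Longrightarrow> finite E"
  unfolding graph_on_def by (rule finite_subset[of _ "Pow V"]) auto

lemma graph_on_edge:
  assumes "graph_on V E" "{a, b} \<in> E"
  shows "a \<noteq> b" "a \<in> V" "b \<in> V"
  using assms unfolding graph_on_def by (auto simp: card_2_iff)

lemma nbrs_sym: "u \<in> nbrs E v \<longleftrightarrow> v \<in> nbrs E u"
  by (simp add: nbrs_def insert_commute)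

lemma nbrs_subset: "graph_on V E \<Longrightarrow> nbrs E v \<subseteq> V - {v}"
  unfolding nbrs_def using graph_on_edge by blast

lemma degree_eq_card_nbrs:
  assumes "graph_on V E"
  shows "degree E v = card (nbrs E v)"
proof -
  have "bij_betw (\<lambda>u. {v, u}) (nbrs E v) {e \<in> E. v \<in> e}"
  proof (rule bij_betwI')
    fix x y assume "x \<in> nbrs E v" "y \<in> nbrs E v"
    then show "({v, x} = {v, y}) = (x = y)" by (auto simp: doubleton_eq_iff)
  next
    fix x assume "x \<in> nbrs E v" then show "{v, x} \<in> {e \<in> E. v \<in> e}" by (auto simp: nbrs_def)
  next
    fix e assume e: "e \<in> {e \<in> E. v \<in> e}"
    then have "card e = 2" using assms by (auto simp: graph_on_def)
    with e obtain u where "e = {v, u}" by (auto simp: card_2_iff)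
    with e show "\<exists>x\<in>nbrs E v. e = {v, x}" by (auto simp: nbrs_def)
  qed
  then show ?thesis unfolding degree_def by (simp add: bij_betw_same_card)
qed

lemma degree_insert:
  assumes "finite E" "e \<notin> E"
  shows "degree (insert e E) i = degree E i + of_bool (i \<in> e)"
proof -
  have "{f \<in> insert e E. i \<in> f} = (if i \<in> e then insert e {f \<in> E. i \<in> f} else {f \<in> E. i \<in> f})"
    by auto
  then show ?thesis using assms by (auto simp: degree_def)
qed

lemma degree_remove:
  assumes "finite E" "e \<in> E"
  shows "degree (E - {e}) i + of_bool (i \<in> e) = degree E i"
  using degree_insert[of "E - {e}" e i] assms by (simp add: insert_absorb)

text \<open>Applied both to edge sets, where it preserves degrees under the conditions of
  \<open>degree_switch\<close>, and to matchings, where it lets two matched pairs trade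
  partners.\<close>

definition switch :: "nat set set \<Rightarrow> nat \<Rightarrow> nat \<Rightarrow> nat \<Rightarrow> nat \<Rightarrow> nat set set" where
  "switch E a x c y = insert {a, y} (insert {c, x} (E - {{a, x}} - {{c, y}}))"

lemma switch_graph_on:
  assumes "graph_on V E" "{a, x} \<in> E" "{c, y} \<in> E" "a \<noteq> y" "c \<noteq> x"
  shows "graph_on V (switch E a x c y)"
  using assms graph_on_edge[OF assms(1)] unfolding graph_on_def switch_def by auto

lemma degree_switch:
  assumes "finite E" "{a, x} \<in> E" "{c, y} \<in> E" "{a, y} \<notin> E" "{c, x} \<notin> E"
    and "a \<noteq> c" "x \<noteq> y" "a \<noteq> y" "c \<noteq> x" "a \<noteq> x" "c \<noteq> y"
  shows "degree (switch E a x c y) i = degree E i"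
proof -
  let ?E1 = "E - {{a, x}}"
  let ?E2 = "?E1 - {{c, y}}"
  let ?E3 = "insert {c, x} ?E2"
  have "degree ?E1 i + of_bool (i \<in> {a, x}) = degree E i"
    using assms by (intro degree_remove) auto
  moreover have "degree ?E2 i + of_bool (i \<in> {c, y}) = degree ?E1 i"
    using assms by (intro degree_remove) (auto simp: doubleton_eq_iff)
  moreover have "degree ?E3 i = degree ?E2 i + of_bool (i \<in> {c, x})"
    using assms by (intro degree_insert) auto
  moreover have "degree (insert {a, y} ?E3) i = degree ?E3 i + of_bool (i \<in> {a, y})"
    using assms by (intro degree_insert) (auto simp: doubleton_eq_iff)
  moreover have "of_bool (i \<in> {a, x}) + of_bool (i \<in> {c, y})
      = (of_bool (i \<in> {c, x}) + of_bool (i \<in> {a, y}) :: nat)"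
    using assms(6-) by (auto simp: of_bool_def)
  ultimately show ?thesis unfolding switch_def by linarith
qed

section \<open>Matchings under switches, and the three exchange arguments\<close>

lemma matching_edge_unique:
  "matching E M \<Longrightarrow> e \<in> M \<Longrightarrow> f \<in> M \<Longrightarrow> v \<in> e \<Longrightarrow> v \<in> f \<Longrightarrow> e = f"
  unfolding matching_def pairwise_def disjnt_def by blast

lemma matching_mate:
  assumes "graph_on V E" "matching E M" "v \<in> \<Union>M"
  obtains w where "{v, w} \<in> M" "{v, w} \<in> E" "v \<noteq> w"
proof -
  from assms obtain e where e: "e \<in> M" "v \<in> e" by auto
  then have "e \<in> E" using assms by (auto simp: matching_def)
  then have "card e = 2" using assms by (auto simp: graph_on_def)
  with e obtain w where "e = {v, w}" "v \<noteq> w" by (auto simp: card_2_iff)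
  with e \<open>e \<in> E\<close> that show ?thesis by auto
qed

text \<open>Every other edge of \<open>M\<close> avoids the four endpoints, so the new pairs collide
  with nothing. \<open>E'\<close> is left open because the new pairs may become edges only through a
  simultaneous switch of the graph.\<close>

lemma matching_rotate:
  assumes M: "matching E M" "{a, b} \<in> M" "{c, d} \<in> M" and "distinct [a, b, c, d]"
    and sub: "switch M a b c d \<subseteq> E'"
  shows "matching E' (switch M a b c d)" "\<Union>(switch M a b c d) = \<Union>M"
proof -
  have u: "e = {a, b} \<or> e = {c, d} \<or> e \<inter> {a, b, c, d} = {}" if "e \<in> M" for e
    using matching_edge_unique[OF M(1) that] M(2,3) by blast
  have p: "pairwise disjnt M" using M by (auto simp: matching_def)
  have el: "e = {a, d} \<or> e = {c, b} \<or> e \<in> M \<and> e \<inter> {a, b, c, d} = {}"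
    if "e \<in> switch M a b c d" for e
    using that u[of e] unfolding switch_def by blast
  have "pairwise disjnt (switch M a b c d)"
  proof (rule pairwiseI)
    fix e f assume ef: "e \<in> switch M a b c d" "f \<in> switch M a b c d" "e \<noteq> f"
    have M': "disjnt e f" if "e \<in> M" "f \<in> M" using p that ef(3) by (auto simp: pairwise_def)
    from el[OF ef(1)] show "disjnt e f"
    proof (elim disjE)
      assume e: "e = {a, d}"
      from el[OF ef(2)] show ?thesis using e ef(3) assms(4) by (auto simp: disjnt_def)
    next
      assume e: "e = {c, b}"
      from el[OF ef(2)] show ?thesis using e ef(3) assms(4) by (auto simp: disjnt_def)
    next
      assume e: "e \<in> M \<and> e \<inter> {a, b, c, d} = {}"
      from el[OF ef(2)] show ?thesis using e M' by (auto simp: disjnt_def)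
    qed
  qed
  with sub show "matching E' (switch M a b c d)" by (auto simp: matching_def)
  show "\<Union>(switch M a b c d) = \<Union>M" using M u unfolding switch_def by auto
qed

text \<open>Remove \<open>p\<close> and \<open>q\<close> from each other's neighbourhoods: adjacency
  of \<open>p\<close> and \<open>q\<close> affects both sides alike, so that of \<open>p\<close> is
  still at least as large. It misses \<open>w\<close>, hence cannot be contained in that of
  \<open>q\<close>. This supplies the extra vertex that a switch requires.\<close>

lemma private_nbr:
  assumes G: "graph_on V E" "finite V" and "degree E q \<le> degree E p"
    and w: "w \<in> nbrs E q" "w \<notin> nbrs E p" "w \<noteq> p"
  obtains x where "x \<in> nbrs E p" "x \<notin> nbrs E q" "x \<noteq> q" "x \<noteq> p"
proof -
  have fin: "finite (nbrs E z)" for z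
    using nbrs_subset[OF G(1), of z] G(2) by (metis finite_Diff finite_subset)
  have "p \<in> nbrs E q \<longleftrightarrow> q \<in> nbrs E p" by (rule nbrs_sym)
  moreover have "card (nbrs E q) \<le> card (nbrs E p)"
    using assms degree_eq_card_nbrs by metis
  ultimately have le: "card (nbrs E q - {p}) \<le> card (nbrs E p - {q})"
    using fin by (auto simp: card_Diff_singleton_if)
  have "\<not> nbrs E p - {q} \<subseteq> nbrs E q - {p}"
  proof
    assume "nbrs E p - {q} \<subseteq> nbrs E q - {p}"
    then have "nbrs E p - {q} \<subset> nbrs E q - {p}" using w by auto
    then have "card (nbrs E p - {q}) < card (nbrs E q - {p})" using fin by (intro psubset_card_mono) auto
    with le show False by simp
  qed
  then show ?thesis using that nbrs_subset[OF G(1), of p] by blast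
qed

text \<open>If \<open>u\<close> is not adjacent to the mate \<open>w\<close> of \<open>u'\<close>, a
  private neighbour \<open>x\<close> of \<open>u\<close> permits switching \<open>ux\<close>,
  \<open>u'w\<close> to \<open>uw\<close>, \<open>u'x\<close>. The edge \<open>ux\<close> is not in
  the matching because \<open>u\<close> is uncovered, so only the edge at \<open>u'\<close> is lost,
  and \<open>uw\<close> replaces it.\<close>

lemma cover_exchange:
  assumes G: "graph_on V E" "finite V" and M: "matching E M"
    and u: "u \<notin> \<Union>M" "u' \<in> \<Union>M" "degree E u' \<le> degree E u"
  obtains E' M' where "graph_on V E'" "\<And>i. degree E' i = degree E i" "matching E' M'"
    "\<Union>M' = insert u (\<Union>M - {u'})" "card M' = card M"
proof -
  from matching_mate[OF G(1) M u(2)] obtain w where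
    w: "{u', w} \<in> M" "{u', w} \<in> E" "u' \<noteq> w" .
  have uw: "u \<noteq> w" "u \<noteq> u'" using u w by auto
  have uq: "e = {u', w} \<or> e \<inter> {u', w} = {}" if "e \<in> M" for e
    using matching_edge_unique[OF M that] w(1) by blast
  have finM: "finite M" using graph_on_finite[OF G(2,1)] M by (auto simp: matching_def finite_subset)
  let ?M = "insert {u, w} (M - {{u', w}})"
  have un: "\<Union>?M = insert u (\<Union>M - {u'})" using uq w uw by auto
  have "{u, w} \<notin> M" using u by auto
  then have cardM: "card ?M = card M" using finM w
    by (metis Diff_iff card_Suc_Diff1 card_insert_disjoint finite_Diff)
  have disj: "pairwise disjnt ?M"
    using M u uq unfolding matching_def pairwise_def disjnt_def by (auto simp: doubleton_eq_iff)
  show ?thesis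
  proof (cases "{u, w} \<in> E")
    case True
    then have "matching E ?M" using disj M by (auto simp: matching_def)
    from that[OF G(1) _ this un cardM] show ?thesis by simp
  next
    case False
    then have "w \<in> nbrs E u'" "w \<notin> nbrs E u" using w by (auto simp: nbrs_def insert_commute)
    from private_nbr[OF G u(3) this] uw obtain x where
      x: "x \<in> nbrs E u" "x \<notin> nbrs E u'" "x \<noteq> u'" "x \<noteq> u" by metis
    let ?E = "switch E u x u' w"
    have E: "{u, x} \<in> E" "{u', x} \<notin> E" using x by (auto simp: nbrs_def)
    have xw: "x \<noteq> w" using E w by auto
    have "?M \<subseteq> ?E" using M u w(1) by (auto simp: switch_def matching_def)
    then have "matching ?E ?M" using disj by (auto simp: matching_def)
    moreover have "graph_on V ?E" using switch_graph_on[OF G(1)] E w x uw by auto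
    moreover have "degree ?E i = degree E i" for i
      using degree_switch[OF graph_on_finite[OF G(2,1)]] E w x uw xw False by auto
    ultimately show ?thesis using that un cardM by blast
  qed
qed

text \<open>With mates \<open>b\<close> of \<open>a\<close> and \<open>c\<close> of
  \<open>d\<close>, the pairs \<open>ad\<close> and \<open>bc\<close> are to become edges.
  Extremality of \<open>a\<close> and \<open>d\<close> yields the degree comparison for
  \<open>private_nbr\<close>: \<open>c\<close> against \<open>a\<close> if \<open>ad\<close> is
  missing, \<open>d\<close> against \<open>b\<close> if \<open>bc\<close> is missing.\<close>

lemma uncross:
  assumes G: "graph_on V E" "finite V" and M: "matching E M"
    and a: "a \<in> \<Union>M" "\<And>u. u \<in> \<Union>M \<Longrightarrow> degree E u \<le> degree E a"
    and d: "d \<in> \<Union>M" "\<And>u. u \<in> \<Union>M \<Longrightarrow> degree E d \<le> degree E u" and "a \<noteq> d"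
  obtains E' M' where "graph_on V E'" "\<And>i. degree E' i = degree E i" "matching E' M'"
    "\<Union>M' = \<Union>M" "{a, d} \<in> M'"
proof -
  from matching_mate[OF G(1) M a(1)] obtain b where b: "{a, b} \<in> M" "{a, b} \<in> E" "a \<noteq> b" .
  from matching_mate[OF G(1) M d(1)] obtain c where c: "{d, c} \<in> M" "{d, c} \<in> E" "d \<noteq> c" .
  show ?thesis
  proof (cases "b = d")
    case True then show ?thesis using that[OF G(1) _ M] b by auto
  next
    case False
    have uqa: "e = {a, b}" if "e \<in> M" "a \<in> e \<or> b \<in> e" for e
      using matching_edge_unique[OF M that(1) b(1)] that by blast
    have uqd: "e = {d, c}" if "e \<in> M" "d \<in> e \<or> c \<in> e" for e
      using matching_edge_unique[OF M that(1) c(1)] that by blast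
    have dist: "distinct [a, b, c, d]" using b c False \<open>a \<noteq> d\<close> uqa[OF c(1)] by (auto simp: doubleton_eq_iff)
    let ?M = "switch M a b c d"
    have inM: "{a, d} \<in> ?M" by (simp add: switch_def)
    have rot: "matching E' ?M" "\<Union>?M = \<Union>M" if "?M \<subseteq> E'" for E'
      using matching_rotate[OF M b(1) _ dist that] c(1) by (auto simp: insert_commute)
    have fE: "finite E" using graph_on_finite[OF G(2,1)] .
    have ME: "M \<subseteq> E" using M by (simp add: matching_def)
    have bc: "b \<in> \<Union>M" "c \<in> \<Union>M" using b c by auto
    \<comment> \<open>If exactly one of the two edges is missing, it is created by a switch through
      a further vertex \<open>x\<close>. This removes the matching edge \<open>cd\<close>, which the
      rotated matching has given up anyway, and an edge at \<open>x\<close> outside the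
      matching.\<close>
    consider "{a, d} \<in> E" "{b, c} \<in> E" | "{a, d} \<notin> E" "{b, c} \<notin> E"
      | "{a, d} \<notin> E" "{b, c} \<in> E" | "{a, d} \<in> E" "{b, c} \<notin> E" by blast
    then show ?thesis
    proof cases
      case 1
      then have "?M \<subseteq> E" using ME by (auto simp: switch_def insert_commute)
      from that[OF G(1) _ rot[OF this] inM] show ?thesis by simp
    next
      case 2
      let ?E = "switch E a b c d"
      have "?M \<subseteq> ?E" using ME by (auto simp: switch_def)
      note rot[OF this]
      moreover have "graph_on V ?E"
        using switch_graph_on[OF G(1)] b c dist by (auto simp: insert_commute)
      moreover have "degree ?E i = degree E i" for i
        using degree_switch[OF fE] b c dist 2 by (auto simp: insert_commute)
      ultimately show ?thesis using that inM by blast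
    next
      case 3
      then have "d \<in> nbrs E c" "d \<notin> nbrs E a" "d \<noteq> a"
        using c dist by (auto simp: nbrs_def insert_commute)
      from private_nbr[OF G a(2)[OF bc(2)] this] obtain x where
        x: "x \<in> nbrs E a" "x \<notin> nbrs E c" "x \<noteq> c" "x \<noteq> a" .
      have E: "{a, x} \<in> E" "{c, x} \<notin> E" using x by (auto simp: nbrs_def)
      have xb: "x \<noteq> b" "x \<noteq> d" using E 3 by (auto simp: insert_commute)
      have "{a, x} \<notin> M" using uqa[of "{a, x}"] xb by (auto simp: doubleton_eq_iff)
      let ?E = "switch E a x c d"
      have "?M \<subseteq> ?E" using ME 3 \<open>{a, x} \<notin> M\<close> dist by (auto simp: switch_def insert_commute doubleton_eq_iff)
      note rot[OF this]
      moreover have "graph_on V ?E"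
        using switch_graph_on[OF G(1) E(1)] c dist x by (auto simp: insert_commute)
      moreover have "degree ?E i = degree E i" for i
        using degree_switch[OF fE E(1)] c dist 3 E x xb by (auto simp: insert_commute)
      ultimately show ?thesis using that inM by blast
    next
      case 4
      then have "c \<in> nbrs E d" "c \<notin> nbrs E b" "c \<noteq> b"
        using c dist by (auto simp: nbrs_def)
      from private_nbr[OF G d(2)[OF bc(1)] this] obtain x where
        x: "x \<in> nbrs E b" "x \<notin> nbrs E d" "x \<noteq> d" "x \<noteq> b" .
      have E: "{b, x} \<in> E" "{d, x} \<notin> E" using x by (auto simp: nbrs_def)
      have xb: "x \<noteq> a" "x \<noteq> c" using E 4 by (auto simp: insert_commute)
      have "{b, x} \<notin> M" using uqa[of "{b, x}"] xb by (auto simp: doubleton_eq_iff)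
      let ?E = "switch E b x d c"
      have "?M \<subseteq> ?E" using ME 4 \<open>{b, x} \<notin> M\<close> dist by (auto simp: switch_def insert_commute doubleton_eq_iff)
      note rot[OF this]
      moreover have "graph_on V ?E"
        using switch_graph_on[OF G(1) E(1)] c dist x by (auto simp: insert_commute)
      moreover have "degree ?E i = degree E i" for i
        using degree_switch[OF fE E(1)] c dist 4 E x xb by (auto simp: insert_commute)
      ultimately show ?thesis using that inM by blast
    qed
  qed
qed

text \<open>The Havel-Hakimi exchange of \<open>vy\<close> for \<open>vx\<close> in the presence of
  a matching. The last hypothesis provides a mate of \<open>y\<close> in the one situation where
  every available switch destroys the matching edge of \<open>x\<close>. The matching edge at
  \<open>v\<close> survives, so that the exchange can be repeated.\<close>

lemma layoff_exchange:
  assumes G: "graph_on V E" "finite V" and M: "matching E M"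
    and vy: "{v, y} \<in> E" "{v, y} \<notin> M" and vx: "{v, x} \<notin> E" "v \<noteq> x"
    and xy: "x \<noteq> y" "degree E y \<le> degree E x"
      "degree E x = degree E y \<Longrightarrow> x \<in> \<Union>M \<Longrightarrow> y \<in> \<Union>M"
  obtains E' M' where "graph_on V E'" "\<And>i. degree E' i = degree E i" "matching E' M'"
    "\<Union>M' = \<Union>M" "nbrs E' v = insert x (nbrs E v - {y})" "\<And>e. e \<in> M \<Longrightarrow> v \<in> e \<Longrightarrow> e \<in> M'"
proof -
  have fE: "finite E" using graph_on_finite[OF G(2,1)] .
  have fin: "finite (nbrs E z)" for z
    using nbrs_subset[OF G(1), of z] G(2) by (metis finite_Diff finite_subset)
  have ME: "M \<subseteq> E" using M by (simp add: matching_def)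
  have nv: "v \<in> nbrs E y" "v \<notin> nbrs E x" "v \<noteq> x" using vy vx by (auto simp: nbrs_def insert_commute)
  have vney: "v \<noteq> y" using graph_on_edge[OF G(1) vy(1)] by simp
  \<comment> \<open>Candidates for the fourth vertex of the switch that removes \<open>vy\<close>
    and \<open>xz\<close> and adds \<open>vx\<close> and \<open>yz\<close>.\<close>
  define D where "D = {z \<in> nbrs E x. z \<notin> nbrs E y \<and> z \<noteq> y \<and> z \<noteq> x}"
  have sw: "graph_on V (switch E v y z x)" "degree (switch E v y z x) i = degree E i"
      "nbrs (switch E v y z x) v = insert x (nbrs E v - {y})" "{x, z} \<in> E" "{y, z} \<notin> E" "v \<noteq> z"
    if "z \<in> D" for z i
  proof -
    have z: "{x, z} \<in> E" "{y, z} \<notin> E" "z \<noteq> x" "z \<noteq> y" using that by (auto simp: D_def nbrs_def)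
    show "{x, z} \<in> E" "{y, z} \<notin> E" by (fact z)+
    show "v \<noteq> z" using z vx by (auto simp: insert_commute)
    show "graph_on V (switch E v y z x)"
      using switch_graph_on[OF G(1) vy(1), of z x] \<open>v \<noteq> z\<close> xy vx z by (auto simp: insert_commute)
    show "degree (switch E v y z x) i = degree E i"
      using degree_switch[OF fE vy(1), of z x] \<open>v \<noteq> z\<close> xy z vx vney
      by (auto simp: insert_commute)
    show "nbrs (switch E v y z x) v = insert x (nbrs E v - {y})"
      using \<open>v \<noteq> z\<close> vx vney z unfolding nbrs_def switch_def
      by (auto simp: doubleton_eq_iff)
  qed
  show ?thesis
  proof (cases "\<exists>z\<in>D. {x, z} \<notin> M")
    case True
    then obtain z where z: "z \<in> D" "{x, z} \<notin> M" by auto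
    have "M \<subseteq> switch E v y z x" using ME vy z(2) by (auto simp: switch_def insert_commute)
    with M have "matching (switch E v y z x) M" by (auto simp: matching_def)
    with sw(1-3)[OF z(1)] that show ?thesis by blast
  next
    case False
    obtain z where z: "z \<in> D"
      using private_nbr[OF G xy(2) nv(1,2)] vx(2) by (auto simp: D_def)
    with False have xz: "{x, z} \<in> M" by auto
    have zx: "z \<noteq> x" "z \<noteq> y" using z by (auto simp: D_def)
    \<comment> \<open>The only private neighbour of \<open>x\<close> is its mate, so \<open>x\<close> and \<open>y\<close> have equal degrees and the mate
      of \<open>y\<close> is also adjacent to \<open>x\<close>: after the switch, \<open>x\<close> and \<open>y\<close> can trade mates.\<close>
    have "D = {z}"
    proof -
      have "z' = z" if "z' \<in> D" for z'
        using matching_edge_unique[OF M xz, of "{x, z'}" x] False that by (auto simp: doubleton_eq_iff)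
      with z show ?thesis by blast
    qed
    then have N: "nbrs E x - {y} - {z} \<subseteq> nbrs E y - {x} - {v}"
    proof (intro subsetI)
      fix t assume t: "t \<in> nbrs E x - {y} - {z}"
      then have "t \<noteq> x" using nbrs_subset[OF G(1), of x] by blast
      moreover have "t \<notin> D" using t \<open>D = {z}\<close> by simp
      ultimately have "t \<in> nbrs E y" using t by (simp add: D_def)
      then show "t \<in> nbrs E y - {x} - {v}" using t \<open>t \<noteq> x\<close> nv(2) by auto
    qed
    have xyN: "y \<in> nbrs E x \<longleftrightarrow> x \<in> nbrs E y" by (rule nbrs_sym)
    have le: "card (nbrs E y) \<le> card (nbrs E x)"
      using degree_eq_card_nbrs[OF G(1)] xy(2) by simp
    have zN: "z \<in> nbrs E x" using z by (simp add: D_def)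
    have cx: "card (nbrs E x - {y}) = Suc (card (nbrs E x - {y} - {z}))"
      using zN zx fin by (metis Diff_iff card_Suc_Diff1 finite_Diff singletonD)
    have cy: "card (nbrs E y - {x}) = Suc (card (nbrs E y - {x} - {v}))"
      using nv fin by (metis Diff_iff card_Suc_Diff1 finite_Diff singletonD)
    \<comment> \<open>Either both neighbourhoods lose an element or neither does, by symmetry of
      adjacency; the additive form avoids truncated subtraction.\<close>
    have cxy: "card (nbrs E x - {y}) + card (nbrs E y) = card (nbrs E y - {x}) + card (nbrs E x)"
      using xyN fin card_gt_0_iff[of "nbrs E x"] card_gt_0_iff[of "nbrs E y"]
      by (auto simp: card_Diff_singleton_if)
    have "card (nbrs E x - {y} - {z}) \<le> card (nbrs E y - {x} - {v})"
      using N fin by (intro card_mono) auto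
    with cx cy cxy le have eqc: "card (nbrs E x) = card (nbrs E y)"
      "card (nbrs E x - {y} - {z}) = card (nbrs E y - {x} - {v})" by linarith+
    then have Neq: "nbrs E x - {y} - {z} = nbrs E y - {x} - {v}"
      using N fin by (intro card_subset_eq) auto
    have "degree E x = degree E y" using eqc degree_eq_card_nbrs[OF G(1)] by simp
    with xy(3) xz have "y \<in> \<Union>M" by auto
    from matching_mate[OF G(1) M this] obtain w where
      w: "{y, w} \<in> M" "{y, w} \<in> E" "y \<noteq> w" .
    have "w \<noteq> x" using matching_edge_unique[OF M w(1) xz, of x] zx xy(1) by (auto simp: doubleton_eq_iff)
    have "w \<noteq> v" using w vy by (auto simp: insert_commute)
    have "w \<in> nbrs E y" using w by (simp add: nbrs_def)
    with Neq \<open>w \<noteq> x\<close> \<open>w \<noteq> v\<close> have "w \<in> nbrs E x - {y} - {z}" by simp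
    then have xw: "{x, w} \<in> E" "w \<noteq> z" by (auto simp: nbrs_def)
    have dist: "distinct [x, z, y, w]" using zx w \<open>w \<noteq> x\<close> xw xy by auto
    let ?M = "switch M x z y w"
    have "?M \<subseteq> switch E v y z x"
      using ME vy xw dist sw(6)[OF z] nv vney \<open>w \<noteq> v\<close>
      by (auto simp: switch_def doubleton_eq_iff insert_commute)
    note rot = matching_rotate[OF M xz w(1) dist this]
    have "e \<in> ?M" if "e \<in> M" "v \<in> e" for e
      using that nv vney sw(6)[OF z] \<open>w \<noteq> v\<close> by (auto simp: switch_def)
    with rot sw(1-3)[OF z] that show ?thesis by blast
  qed
qed

section \<open>Laying off a vertex\<close>

text \<open>
  When the vertices below \<open>v\<close> have been laid off, \<open>block m v\<close> consists of the vertices that still have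
  to be matched; vertex \<open>i < m\<close> is matched with \<open>2 * m - 1 - i\<close>.
\<close>

definition block :: "nat \<Rightarrow> nat \<Rightarrow> nat set" where
  "block m v = {u. v \<le> u \<and> u + v < 2 * m}"

text \<open>The covered set is prescribed exactly, not just the size of the matching, so that
  deleting \<open>v\<close> together with its matching edge leaves a problem of the same form. For
  \<open>v >= m\<close> the block is empty and only realizability remains.\<close>

definition feasible :: "nat \<Rightarrow> nat \<Rightarrow> nat \<Rightarrow> (nat \<Rightarrow> nat) \<Rightarrow> bool" where
  "feasible n m v r \<longleftrightarrow>
    (\<exists>E M. graph_on {v..<n} E \<and> (\<forall>i\<in>{v..<n}. degree E i = r i) \<and> matching E M \<and> \<Union>M = block m v)"

text \<open>Makes \<open>v\<close> a vertex of largest and \<open>2 * m - 1 - v\<close> one of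
  smallest residual degree in the block, as \<open>uncross\<close> demands.\<close>

definition block_sorted :: "nat \<Rightarrow> nat \<Rightarrow> (nat \<Rightarrow> nat) \<Rightarrow> bool" where
  "block_sorted m v r \<longleftrightarrow> (\<forall>i\<in>block m v. \<forall>j\<in>block m v. i \<le> j \<longrightarrow> r j \<le> r i)"

text \<open>
  The order in which the neighbours of \<open>v\<close> are chosen: first its mate, then by decreasing residual
  degree. Ties are broken in favour of vertices outside the block, since a matched vertex cannot
  always replace an unmatched one of the same degree, and then in favour of large indices, which
  keeps the block sorted. Vertices without residual degree get key 0 and are never chosen.
\<close>

definition key :: "nat \<Rightarrow> nat \<Rightarrow> nat \<Rightarrow> (nat \<Rightarrow> nat) \<Rightarrow> nat \<Rightarrow> nat" where
  "key n m v r u =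
    (if r u = 0 then 0 else if u + v + 1 = 2 * m then 2 * n
     else 2 * r u + (if u + v < 2 * m then 0 else 1))"

definition preceding :: "nat \<Rightarrow> nat \<Rightarrow> nat \<Rightarrow> (nat \<Rightarrow> nat) \<Rightarrow> nat \<Rightarrow> nat set" where
  "preceding n m v r j = {i\<in>{v<..<n}.
     key n m v r j < key n m v r i \<or> key n m v r j = key n m v r i \<and> j < i}"

definition selected :: "nat \<Rightarrow> nat \<Rightarrow> nat \<Rightarrow> (nat \<Rightarrow> nat) \<Rightarrow> nat set" where
  "selected n m v r = {j\<in>{v<..<n}. 0 < r j \<and> card (preceding n m v r j) < r v}"

text \<open>The value at \<open>v\<close> is the shortage: it is positive iff fewer than
  \<open>r v\<close> later vertices have positive residual degree.\<close>

definition residual :: "nat \<Rightarrow> nat \<Rightarrow> nat \<Rightarrow> (nat \<Rightarrow> nat) \<Rightarrow> nat \<Rightarrow> nat" where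
  "residual n m v r i =
    (if i = v then r v - card (selected n m v r) else r i - of_bool (i \<in> selected n m v r))"

text \<open>Induction by removing the least element: all others lie above it, so it is counted iff
  \<open>k\<close> exceeds their number, and no other rank changes.\<close>

lemma card_top:
  fixes f :: "'a \<Rightarrow> 'b::linorder"
  assumes "finite A" "inj_on f A"
  shows "card {j\<in>A. card {i\<in>A. f j < f i} < k} = min k (card A)"
  using assms
proof (induction "card A" arbitrary: A k)
  case 0
  then show ?case by simp
next
  case (Suc c)
  then have "A \<noteq> {}" by auto
  define a where "a = arg_min_on f A"
  have a: "a \<in> A" "\<And>x. x \<in> A \<Longrightarrow> f a \<le> f x"
    unfolding a_def using arg_min_if_finite[OF \<open>finite A\<close> \<open>A \<noteq> {}\<close>, of f] by (auto simp: not_less)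
  have less: "f a < f x" if "x \<in> A" "x \<noteq> a" for x
    using a that Suc.prems(2) by (metis inj_onD order.not_eq_order_implies_strict)
  let ?B = "A - {a}"
  have cB: "card ?B = c" using Suc a by simp
  have IH: "card {j\<in>?B. card {i\<in>?B. f j < f i} < k} = min k c"
    using Suc.hyps(1)[OF cB[symmetric], of k] cB Suc.prems by (auto simp: inj_on_diff)
  have same: "{i\<in>A. f j < f i} = {i\<in>?B. f j < f i}" if "j \<in> ?B" for j
    using less[of j] that by auto
  have atop: "{i\<in>A. f a < f i} = ?B" using less by auto
  have "j \<in> {j\<in>A. card {i\<in>A. f j < f i} < k}
      \<longleftrightarrow> j \<in> {j\<in>?B. card {i\<in>?B. f j < f i} < k} \<union> (if c < k then {a} else {})" for j
  proof (cases "j = a")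
    case True
    then show ?thesis unfolding True using atop cB a(1) by simp
  next
    case False
    then show ?thesis using same[of j] by (cases "j \<in> A") simp_all
  qed
  then have "{j\<in>A. card {i\<in>A. f j < f i} < k}
      = {j\<in>?B. card {i\<in>?B. f j < f i} < k} \<union> (if c < k then {a} else {})" by blast
  also have "card \<dots> = min k c + (if c < k then 1 else 0)"
    using IH Suc.prems(1) by (subst card_Un_disjoint) auto
  also have "\<dots> = min k (card A)" using Suc.hyps(2) by auto
  finally show ?case .
qed

section \<open>Properties of the greedy choice at one vertex\<close>

context
  fixes n m v :: nat and r :: "nat \<Rightarrow> nat"
begin

text \<open>Since indices are below \<open>n\<close>, the number \<open>key * n + index\<close>
  encodes the lexicographic order behind \<open>preceding\<close>; injectivity makes
  \<open>card_top\<close> applicable.\<close>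

private lemma rank_inj: "inj_on (\<lambda>j. key n m v r j * n + j) {v<..<n}"
  and rank_less: "\<And>i j. i < n \<Longrightarrow> j < n \<Longrightarrow> key n m v r j * n + j < key n m v r i * n + i \<longleftrightarrow>
     key n m v r j < key n m v r i \<or> key n m v r j = key n m v r i \<and> j < i"
proof -
  have 1: "a * n + j < b * n + i" if "a < b" "j < n" for a b i j :: nat
  proof -
    have "Suc a * n \<le> b * n" using that by (intro mult_right_mono) auto
    with that show ?thesis by simp
  qed
  show less: "key n m v r j * n + j < key n m v r i * n + i \<longleftrightarrow>
     key n m v r j < key n m v r i \<or> key n m v r j = key n m v r i \<and> j < i"
    if "i < n" "j < n" for i j
  proof (cases "key n m v r j" "key n m v r i" rule: linorder_cases)
    case greater
    from 1[OF this, of i j] that greater show ?thesis by simp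
  qed (use 1[of "key n m v r j" "key n m v r i" j i] that in auto)
  show "inj_on (\<lambda>j. key n m v r j * n + j) {v<..<n}"
  proof (intro inj_onI)
    fix i j assume ij: "i \<in> {v<..<n}" "j \<in> {v<..<n}" "key n m v r i * n + i = key n m v r j * n + j"
    then show "i = j" using less[of i j] less[of j i] by auto
  qed
qed

text \<open>Vertices without residual degree have key 0 and precede no vertex of positive key, so
  ranks may be computed among the others.\<close>

lemma card_selected_eq: "card (selected n m v r) = min (r v) (card {j\<in>{v<..<n}. 0 < r j})"
proof -
  let ?A = "{j\<in>{v<..<n}. 0 < r j}"
  have "preceding n m v r j = {i\<in>?A. key n m v r j * n + j < key n m v r i * n + i}" if "j \<in> ?A" for j
  proof -
    have "0 < key n m v r j" using that by (auto simp: key_def)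
    moreover have "0 < r i" if "0 < key n m v r i" for i using that by (auto simp: key_def split: if_splits)
    ultimately show ?thesis using that unfolding preceding_def by (auto simp: rank_less)
  qed
  then have "selected n m v r =
      {j\<in>?A. card {i\<in>?A. key n m v r j * n + j < key n m v r i * n + i} < r v}"
    unfolding selected_def by auto
  moreover have "inj_on (\<lambda>j. key n m v r j * n + j) ?A"
    using rank_inj by (rule inj_on_subset) auto
  ultimately show ?thesis using card_top[of ?A "\<lambda>j. key n m v r j * n + j" "r v"] by simp
qed

lemma finite_selected: "finite (selected n m v r)"
  by (simp add: selected_def)

lemma card_selected_le: "card (selected n m v r) \<le> r v"
  by (simp add: card_selected_eq)

text \<open>A vertex ranked at or above a selected one has no more predecessors than it, so with
  positive residual degree it is selected as well.\<close>

lemma selected_top: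
  assumes "x \<in> selected n m v r" "y \<in> {v<..<n} - selected n m v r" "0 < r y"
  shows "key n m v r y \<le> key n m v r x" "key n m v r y = key n m v r x \<Longrightarrow> y < x"
proof -
  have x: "x \<in> {v<..<n}" "card (preceding n m v r x) < r v" using assms by (auto simp: selected_def)
  have y: "r v \<le> card (preceding n m v r y)" using assms by (auto simp: selected_def)
  have *: False if "key n m v r x < key n m v r y \<or> key n m v r x = key n m v r y \<and> x \<le> y"
  proof -
    have "preceding n m v r y \<subseteq> preceding n m v r x"
      unfolding preceding_def using that by auto
    then have "card (preceding n m v r y) \<le> card (preceding n m v r x)"
      by (intro card_mono) (auto simp: preceding_def)
    with x y show False by simp
  qed
  then show "key n m v r y \<le> key n m v r x" "key n m v r y = key n m v r x \<Longrightarrow> y < x"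
    by (auto simp: not_less[symmetric])
qed

text \<open>The bound \<open>r i < n\<close> keeps all other keys below \<open>2 * n\<close>, so
  nothing precedes the mate.\<close>

lemma mate_selected:
  assumes "v < m" "2 * m \<le> n" "0 < r v" "0 < r (2 * m - 1 - v)" "\<forall>i<n. r i < n"
  shows "2 * m - 1 - v \<in> selected n m v r"
proof -
  let ?p = "2 * m - 1 - v"
  have p: "v < ?p" "?p < n" "?p + v + 1 = 2 * m" using assms by auto
  have less: "key n m v r i < key n m v r ?p" if "i < n" "i \<noteq> ?p" for i
  proof -
    have "key n m v r ?p = 2 * n" using p assms(4) by (simp add: key_def)
    moreover have "i + v + 1 \<noteq> 2 * m" "r i < n" using that p assms(5) by auto
    ultimately show ?thesis by (auto simp: key_def)
  qed
  have "i \<notin> preceding n m v r ?p" for i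
  proof (cases "i = ?p")
    case True
    show ?thesis unfolding True preceding_def by simp
  next
    case False
    show ?thesis
    proof
      assume "i \<in> preceding n m v r ?p"
      then have "i < n" "key n m v r ?p \<le> key n m v r i" unfolding preceding_def by fastforce+
      with less[OF _ False] show False by simp
    qed
  qed
  then have "preceding n m v r ?p = {}" by blast
  with p assms show ?thesis by (auto simp: selected_def)
qed

text \<open>Order could only be lost where \<open>r i = r j\<close> with \<open>i < j\<close> and
  only \<open>i\<close> is lowered. Both lie in the block and neither is the mate of
  \<open>v\<close>, so their keys agree and the tie goes to \<open>j\<close>.\<close>

lemma residual_sorted:
  assumes "block_sorted m v r" "2 * m \<le> n"
  shows "block_sorted m (Suc v) (residual n m v r)"
  unfolding block_sorted_def
proof (intro ballI impI)
  fix i j assume ij: "i \<in> block m (Suc v)" "j \<in> block m (Suc v)" "i \<le> j"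
  then have b: "v < i" "v < j" "i + v + 1 < 2 * m" "j + v + 1 < 2 * m" "i \<noteq> v" "j \<noteq> v" "i < n" "j < n"
    using assms(2) by (auto simp: block_def)
  then have le: "r j \<le> r i" using assms(1) ij by (auto simp: block_sorted_def block_def)
  show "residual n m v r j \<le> residual n m v r i"
  proof (cases "i \<in> selected n m v r \<and> j \<notin> selected n m v r \<and> r i = r j")
    case True
    then have "0 < r j" "key n m v r j = key n m v r i" using b by (auto simp: selected_def key_def)
    with selected_top(2)[of i j] True b ij show ?thesis by auto
  next
    case False
    then show ?thesis using le b by (auto simp: residual_def)
  qed
qed

lemma feasible_pos:
  assumes "feasible n m v r" "v < m"
  shows "0 < r v" "0 < r (2 * m - 1 - v)" "2 * m - 1 - v < n"
proof -
  from assms(1) obtain E M where E: "graph_on {v..<n} E" "\<forall>i\<in>{v..<n}. degree E i = r i"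
    and M: "matching E M" "\<Union>M = block m v" by (auto simp: feasible_def)
  have *: "0 < r a \<and> a < n" if "a \<in> block m v" for a
  proof -
    from that M(2) have "a \<in> \<Union>M" by simp
    from matching_mate[OF E(1) M(1) this] obtain w where w: "{a, w} \<in> E" by metis
    then have "w \<in> nbrs E a" by (simp add: nbrs_def)
    moreover have "finite (nbrs E a)" using nbrs_subset[OF E(1), of a] finite_subset by blast
    ultimately have "0 < degree E a" using degree_eq_card_nbrs[OF E(1)] card_gt_0_iff by fastforce
    with graph_on_edge[OF E(1) w] E(2) show ?thesis by auto
  qed
  show "0 < r v" "0 < r (2 * m - 1 - v)" "2 * m - 1 - v < n"
    using *[of v] *[of "2 * m - 1 - v"] assms(2) by (auto simp: block_def)
qed

text \<open>Among the solutions with the prescribed matching edge at \<open>v\<close>, take one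
  whose neighbourhood of \<open>v\<close> misses the fewest selected vertices. If it missed any,
  \<open>layoff_exchange\<close> would improve it; so the neighbours of \<open>v\<close> are the
  selected vertices, and deleting \<open>v\<close> leaves the residual problem.\<close>

lemma residual_feasible:
  assumes feas: "feasible n m v r" and sorted: "block_sorted m v r" and "v < n" "2 * m \<le> n"
    and bound: "\<forall>i<n. r i < n"
  shows "card (selected n m v r) = r v" "feasible n m (Suc v) (residual n m v r)"
proof -
  let ?V = "{v..<n}" and ?S = "selected n m v r" and ?p = "2 * m - 1 - v"
  define good where "good E M \<longleftrightarrow> graph_on ?V E \<and> (\<forall>i\<in>?V. degree E i = r i) \<and> matching E M \<and>
     \<Union>M = block m v \<and> (v < m \<longrightarrow> {v, ?p} \<in> M)" for E M
  have fV: "finite ?V" by simp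
  from feas obtain E M where E: "graph_on ?V E" "\<forall>i\<in>?V. degree E i = r i"
    and M: "matching E M" "\<Union>M = block m v" by (auto simp: feasible_def)
  have "\<exists>E M. good E M"
  proof (cases "v < m")
    case False
    with E M show ?thesis unfolding good_def by blast
  next
    case True
    have block: "v \<in> block m v" "?p \<in> block m v" using True by (auto simp: block_def)
    have r: "degree E u = r u" if "u \<in> block m v" for u
      using that assms(4) E(2) by (auto simp: block_def)
    have "degree E u \<le> degree E v" "degree E ?p \<le> degree E u" if "u \<in> block m v" for u
      unfolding r[OF that] r[OF block(1)] r[OF block(2)]
      using sorted block that by (auto simp: block_sorted_def block_def)
    moreover have "v \<noteq> ?p" using True by presburger
    ultimately obtain E' M' where "graph_on ?V E'" "\<And>i. degree E' i = degree E i" "matching E' M'"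
      "\<Union>M' = \<Union>M" "{v, ?p} \<in> M'"
      using uncross[OF E(1) fV M(1), of v ?p] block M(2) \<open>v \<noteq> ?p\<close> by metis
    then show ?thesis using E M unfolding good_def by auto
  qed
  then obtain E0 M0 where "good E0 M0" by auto
  define P where "P x \<longleftrightarrow> (case x of (E, M) \<Rightarrow> good E M)" for x :: "nat set set \<times> nat set set"
  have "P (E0, M0)" using \<open>good E0 M0\<close> by (simp add: P_def)
  from ex_has_least_nat[of P, OF this, of "\<lambda>(E, M). card (?S - nbrs E v)"]
  obtain E M where "good E M"
    and least: "\<And>E' M'. good E' M' \<Longrightarrow> card (?S - nbrs E v) \<le> card (?S - nbrs E' v)"
    by (auto simp: P_def)
  then have E: "graph_on ?V E" "\<And>i. i \<in> ?V \<Longrightarrow> degree E i = r i"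
    and M: "matching E M" "\<Union>M = block m v" "v < m \<Longrightarrow> {v, ?p} \<in> M" by (auto simp: good_def)
  have rv: "r v = card (nbrs E v)" using E degree_eq_card_nbrs[OF E(1), of v] \<open>v < n\<close> by auto
  have finN: "finite (nbrs E z)" for z using nbrs_subset[OF E(1), of z] finite_subset by blast
  have Nsub: "nbrs E v \<subseteq> {j\<in>{v<..<n}. 0 < r j}"
  proof
    fix y assume y: "y \<in> nbrs E v"
    then have "v \<in> nbrs E y" by (simp add: nbrs_sym)
    then have "0 < degree E y" using degree_eq_card_nbrs[OF E(1)] finN card_gt_0_iff by fastforce
    with y nbrs_subset[OF E(1), of v] E(2)[of y] show "y \<in> {j\<in>{v<..<n}. 0 < r j}" by force
  qed
  have "r v \<le> card {j\<in>{v<..<n}. 0 < r j}" unfolding rv using Nsub by (intro card_mono) auto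
  then show cardS: "card ?S = r v" by (simp add: card_selected_eq)
  have pS: "?p \<in> ?S" if "v < m"
    using mate_selected feasible_pos[OF feas that] assms that by blast
  have "?S \<subseteq> nbrs E v"
  proof (rule ccontr)
    assume "\<not> ?thesis"
    then obtain x where x: "x \<in> ?S" "x \<notin> nbrs E v" by auto
    have "\<not> nbrs E v \<subseteq> ?S"
    proof
      assume "nbrs E v \<subseteq> ?S"
      with x have "nbrs E v \<subset> ?S" by auto
      from psubset_card_mono[OF finite_selected this] cardS rv show False by simp
    qed
    then obtain y where y: "y \<in> nbrs E v" "y \<notin> ?S" by auto
    have xv: "v < x" "x < n" "0 < r x" using x by (auto simp: selected_def)
    have yv: "v < y" "y < n" "0 < r y" using y Nsub by auto
    have xy: "x \<noteq> y" using x y by auto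
    have "x \<noteq> ?p" if "v < m" using M(1) M(3)[OF that] x by (auto simp: matching_def nbrs_def)
    then have nxp: "x + v + 1 \<noteq> 2 * m" using xv by auto
    have "y \<noteq> ?p" if "v < m" using pS[OF that] y by auto
    then have nyp: "y + v + 1 \<noteq> 2 * m" using yv by auto
    have k: "key n m v r y \<le> key n m v r x" using selected_top(1)[OF x(1)] y yv by auto
    have vM: "{v, y} \<notin> M"
    proof
      assume vy: "{v, y} \<in> M"
      then have "v \<in> block m v" using M(2) by auto
      then have "v < m" by (auto simp: block_def)
      with matching_edge_unique[OF M(1) vy M(3), of v] \<open>v < m \<Longrightarrow> y \<noteq> ?p\<close> yv
      show False by (auto simp: doubleton_eq_iff)
    qed
    have r: "degree E x = r x" "degree E y = r y" using E xv yv by auto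
    \<comment> \<open>Neither vertex is the mate of \<open>v\<close>, so both keys have the form
      twice the degree plus a bit. Comparing them compares degrees first and then the bits, which
      are 0 inside the block.\<close>
    have "degree E y \<le> degree E x" "degree E x = degree E y \<Longrightarrow> x \<in> \<Union>M \<Longrightarrow> y \<in> \<Union>M"
      unfolding r M(2) using k nxp nyp xv yv by (auto simp: key_def block_def split: if_splits)
    then obtain E' M' where E': "graph_on ?V E'" "\<And>i. degree E' i = degree E i" "matching E' M'"
      "\<Union>M' = \<Union>M" "nbrs E' v = insert x (nbrs E v - {y})" "\<And>e. e \<in> M \<Longrightarrow> v \<in> e \<Longrightarrow> e \<in> M'"
      using layoff_exchange[OF E(1) fV M(1) _ vM _ _ xy] x y xv by (auto simp: nbrs_def)
    then have "good E' M'" using E M unfolding good_def by auto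
    from least[OF this] have "card (?S - nbrs E v) \<le> card (?S - nbrs E' v)" .
    moreover have "?S - nbrs E' v \<subset> ?S - nbrs E v" using E'(5) x y by auto
    then have "card (?S - nbrs E' v) < card (?S - nbrs E v)"
      by (intro psubset_card_mono) (auto simp: finite_selected)
    ultimately show False by simp
  qed
  then have SN: "?S = nbrs E v" using cardS rv finN by (intro card_subset_eq) auto
  let ?E = "{e\<in>E. v \<notin> e}" and ?M = "{e\<in>M. v \<notin> e}"
  have V: "?V - {v} = {Suc v..<n}" using \<open>v < n\<close> by auto
  have "graph_on (?V - {v}) ?E" using E(1) unfolding graph_on_def by blast
  then have "graph_on {Suc v..<n} ?E" unfolding V .
  moreover have "degree ?E i = residual n m v r i" if "i \<in> {Suc v..<n}" for i
  proof -
    have "nbrs ?E i = nbrs E i - {v}" using that by (auto simp: nbrs_def)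
    then have "degree ?E i = card (nbrs E i - {v})"
      using degree_eq_card_nbrs[OF \<open>graph_on {Suc v..<n} ?E\<close>] by simp
    also have "\<dots> = card (nbrs E i) - of_bool (v \<in> nbrs E i)" by (auto simp: card_Diff_singleton_if)
    also have "\<dots> = r i - of_bool (i \<in> ?S)"
      using that E(2)[of i] degree_eq_card_nbrs[OF E(1)] SN nbrs_sym[of v E i] by auto
    finally show ?thesis using that by (auto simp: residual_def)
  qed
  moreover have "matching ?E ?M" using M(1) by (auto simp: matching_def pairwise_def)
  moreover have "\<Union>?M = block m (Suc v)"
  proof (cases "v < m")
    case False
    then have "block m v = {}" "block m (Suc v) = {}" by (auto simp: block_def)
    then show ?thesis using M(2) by auto
  next
    case True
    have "e = {v, ?p} \<or> e \<inter> {v, ?p} = {}" if "e \<in> M" for e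
      using matching_edge_unique[OF M(1) that M(3)[OF True]] by blast
    then have "\<Union>?M = \<Union>M - {v, ?p}" using M(3)[OF True] by auto
    also have "\<dots> = block m (Suc v)" unfolding M(2) using True by (auto simp: block_def)
    finally show ?thesis .
  qed
  ultimately show "feasible n m (Suc v) (residual n m v r)" unfolding feasible_def by blast
qed

end

section \<open>Greedy construction and maximum matchings\<close>

lemma realizes_graph_on: "realizes d E \<longleftrightarrow> graph_on {..<length d} E \<and> (\<forall>i<length d. degree E i = d ! i)"
  by (simp add: realizes_def simple_graph_def graph_on_def)

lemma matching_number_attained:
  assumes "graph_on V E" "finite V"
  obtains M where "matching E M" "card M = matching_number E"
    and "\<And>M. matching E M \<Longrightarrow> card M \<le> matching_number E"
proof -
  let ?C = "{card M | M. matching E M}"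
  have "finite (Pow E)" using graph_on_finite[OF assms(2,1)] by simp
  moreover have "?C \<subseteq> card ` Pow E" by (auto simp: matching_def)
  ultimately have fin: "finite ?C" by (meson finite_imageI finite_subset)
  have "matching E {}" by (simp add: matching_def)
  then have "?C \<noteq> {}" by blast
  from Max_in[OF fin this] obtain M where "matching E M" "card M = matching_number E"
    unfolding matching_number_def by auto
  moreover have "card M \<le> matching_number E" if "matching E M" for M
    unfolding matching_number_def using fin that by (intro Max_ge) auto
  ultimately show ?thesis using that by blast
qed

lemma MM_attained:
  assumes "realizes d E0"
  obtains E M where "realizes d E" "matching E M" "card M = MM d"
    and "\<And>E M. realizes d E \<Longrightarrow> matching E M \<Longrightarrow> card M \<le> MM d"
proof -
  let ?C = "{matching_number E | E. realizes d E}"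
  have "?C \<subseteq> matching_number ` Pow (Pow {..<length d})"
    by (auto simp: realizes_graph_on graph_on_def)
  moreover have "finite (Pow (Pow {..<length d}))" by simp
  ultimately have fin: "finite ?C" by (meson finite_imageI finite_subset)
  have "?C \<noteq> {}" using assms by blast
  from Max_in[OF fin this] obtain E where E: "realizes d E" "matching_number E = MM d"
    unfolding MM_def by auto
  have "card M \<le> MM d" if E: "realizes d E" and "matching E M" for E M
  proof -
    have "graph_on {..<length d} E" using E by (simp add: realizes_graph_on)
    then have "card M \<le> matching_number E"
      by (rule matching_number_attained[OF _ finite_lessThan]) (use that in blast)
    also have "\<dots> \<le> MM d" unfolding MM_def using fin E by (intro Max_ge) auto
    finally show ?thesis .
  qed
  moreover have "graph_on {..<length d} E" using E by (simp add: realizes_graph_on)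
  then obtain M where "matching E M" "card M = matching_number E"
    by (rule matching_number_attained[OF _ finite_lessThan])
  ultimately show ?thesis using that E by metis
qed

lemma card_Union_matching:
  assumes "graph_on V E" "finite V" "matching E M"
  shows "card (\<Union>M) = 2 * card M"
proof -
  have "card (\<Union>M) = sum card M"
    using assms by (intro card_Union_disjoint)
      (auto simp: matching_def graph_on_def intro: finite_subset[OF _ assms(2)])
  also have "\<dots> = sum (\<lambda>_. 2) M"
    using assms by (intro sum.cong) (auto simp: matching_def graph_on_def)
  finally show ?thesis by simp
qed

text \<open>As exactly \<open>2 * m\<close> vertices are covered, where \<open>m\<close> is the size
  of the matching, a covered vertex outside the first \<open>2 * m\<close> leaves one of these
  uncovered. The latter has at least the same degree, and \<open>cover_exchange\<close> brings the
  covered set closer to the initial segment.\<close>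

lemma feasible_of_matching:
  assumes "sorted_wrt (\<ge>) d" and E0: "realizes d E0" "matching E0 M0"
  shows "feasible (length d) (card M0) 0 ((!) d)"
proof -
  let ?n = "length d" and ?m = "card M0"
  define P where "P = (\<lambda>(E, M). realizes d E \<and> matching E M \<and> card M = ?m)"
  have "P (E0, M0)" using E0 by (simp add: P_def)
  from ex_has_least_nat[of P, OF this, of "\<lambda>(E, M). card (\<Union>M - {..<2 * ?m})"]
  obtain E M where real: "realizes d E" and M: "matching E M" "card M = ?m"
    and least: "\<And>E' M'. realizes d E' \<Longrightarrow> matching E' M' \<Longrightarrow> card M' = ?m \<Longrightarrow>
      card (\<Union>M - {..<2 * ?m}) \<le> card (\<Union>M' - {..<2 * ?m})"
    by (auto simp: P_def)
  from real have E: "graph_on {..<?n} E" "\<And>i. i < ?n \<Longrightarrow> degree E i = d ! i"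
    by (auto simp: realizes_graph_on)
  have cU: "card (\<Union>M) = 2 * ?m" using card_Union_matching[OF E(1) _ M(1)] M(2) by simp
  have Usub: "\<Union>M \<subseteq> {..<?n}" using E(1) M(1) unfolding graph_on_def matching_def by blast
  then have finU: "finite (\<Union>M)" using finite_subset by blast
  have sub: "\<Union>M \<subseteq> {..<2 * ?m}"
  proof (rule ccontr)
    assume "\<not> ?thesis"
    then obtain u' where u': "u' \<in> \<Union>M" "u' \<notin> {..<2 * ?m}" by blast
    have "\<not> {..<2 * ?m} \<subseteq> \<Union>M"
    proof
      assume "{..<2 * ?m} \<subseteq> \<Union>M"
      with u' have "{..<2 * ?m} \<subset> \<Union>M" by blast
      from psubset_card_mono[OF finU this] cU show False by simp
    qed
    then obtain u where u: "u < 2 * ?m" "u \<notin> \<Union>M" by auto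
    have "u < u'" using u u' by simp
    moreover have "u' < ?n" using u' Usub by auto
    ultimately have "degree E u' \<le> degree E u"
      using E(2) assms(1) by (auto simp: sorted_wrt_iff_nth_less)
    from cover_exchange[OF E(1) _ M(1) u(2) u'(1) this]
    obtain E' M' where E': "graph_on {..<?n} E'" "\<And>i. degree E' i = degree E i" "matching E' M'"
      "\<Union>M' = insert u (\<Union>M - {u'})" "card M' = card M" by auto
    have "card (\<Union>M - {..<2 * ?m}) \<le> card (\<Union>M' - {..<2 * ?m})"
      using E' E M by (intro least) (auto simp: realizes_graph_on)
    moreover have "\<Union>M' - {..<2 * ?m} = (\<Union>M - {..<2 * ?m}) - {u'}" unfolding E'(4) using u by auto
    moreover have "card ((\<Union>M - {..<2 * ?m}) - {u'}) < card (\<Union>M - {..<2 * ?m})"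
      using u' finU by (intro card_Diff1_less) auto
    ultimately show False by simp
  qed
  then have "\<Union>M = {..<2 * ?m}" using cU by (intro card_subset_eq) auto
  then show ?thesis unfolding feasible_def block_def lessThan_atLeast0[symmetric]
    using E M(1) by (intro exI[of _ E] exI[of _ M]) (auto simp: lessThan_def)
qed

text \<open>
  After the rows of the vertices below \<open>v\<close> have been written, \<open>r\<close> holds the degrees still to be
  realized, \<open>A\<close> is the adjacency matrix, and \<open>bad \<noteq> 0\<close> means that the attempt has failed. The last
  conjunct states that this cannot happen if \<open>m\<close> is feasible.
\<close>

definition rows_done ::
  "nat \<Rightarrow> nat \<Rightarrow> nat \<Rightarrow> (nat \<Rightarrow> nat) \<Rightarrow> (nat \<Rightarrow> nat) \<Rightarrow> (nat \<Rightarrow> nat \<Rightarrow> nat) \<Rightarrow> nat \<Rightarrow> bool" where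
  "rows_done n m v d r A bad \<longleftrightarrow>
    (\<exists>E. graph_on {..<n} E \<and> (\<forall>e\<in>E. \<exists>i\<in>e. i < v) \<and> (\<forall>i<n. r i + degree E i = d i) \<and>
      (\<forall>i<n. \<forall>j<n. i < v \<or> j < v \<longrightarrow> A i j = of_bool ({i, j} \<in> E)) \<and>
      (bad = 0 \<longrightarrow> (\<forall>i<v. r i = 0 \<and> (i < m \<longrightarrow> {i, 2 * m - 1 - i} \<in> E)))) \<and>
    (feasible n m 0 d \<longrightarrow> bad = 0 \<and> feasible n m v r \<and> block_sorted m v r)"

text \<open>The degree balance survives even a failed run, because at most \<open>r v\<close>
  vertices are selected and all of them have positive residual degree; feasibility enters only in
  the last conjunct. The diagonal is never written, hence the hypothesis
  \<open>diag\<close>.\<close>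

lemma rows_done_step:
  assumes inv: "rows_done n m v d r A bad" and "v < n" "2 * m \<le> n" and d: "\<forall>i<n. d i < n"
    and diag: "A v v = 0"
    and A': "\<And>i j. i < n \<Longrightarrow> j < n \<Longrightarrow> A' i j =
      (if i = v \<and> v < j then of_bool (j \<in> selected n m v r)
       else if j = v \<and> v < i then of_bool (i \<in> selected n m v r) else A i j)"
    and bad': "bad' = (if 0 < residual n m v r v \<or> v < m \<and> A' v (2 * m - 1 - v) = 0 then 1 else bad)"
  shows "rows_done n m (Suc v) d (residual n m v r) A' bad'"
proof -
  let ?S = "selected n m v r" and ?r = "residual n m v r"
  from inv obtain E where E0: "graph_on {..<n} E" "\<forall>e\<in>E. \<exists>i\<in>e. i < v"
    "\<forall>i<n. r i + degree E i = d i"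
    "\<forall>i<n. \<forall>j<n. i < v \<or> j < v \<longrightarrow> A i j = of_bool ({i, j} \<in> E)"
    and bad: "bad = 0 \<longrightarrow> (\<forall>i<v. r i = 0 \<and> (i < m \<longrightarrow> {i, 2 * m - 1 - i} \<in> E))"
    and feas: "feasible n m 0 d \<Longrightarrow> bad = 0 \<and> feasible n m v r \<and> block_sorted m v r"
    unfolding rows_done_def by (elim conjE exE) simp
  have E5: "r i = 0" if "bad = 0" "i < v" for i
    using bad that by blast
  have E6: "{i, 2 * m - 1 - i} \<in> E" if "bad = 0" "i < v" "i < m" for i
    using bad that by blast
  note E = E0(1) E0(2)[rule_format] E0(3)[rule_format] E0(4)[rule_format] E5 E6
  define E' where "E' = E \<union> (\<lambda>u. {v, u}) ` ?S"
  have S: "?S \<subseteq> {v<..<n}" "\<And>u. u \<in> ?S \<Longrightarrow> 0 < r u" by (auto simp: selected_def)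
  have edge: "{i, j} \<in> E' \<longleftrightarrow> {i, j} \<in> E \<or> i = v \<and> j \<in> ?S \<or> j = v \<and> i \<in> ?S" for i j
    by (auto simp: E'_def doubleton_eq_iff image_iff)
  have new: "{v, u} \<notin> E" if "v \<le> u" for u using E(2)[of "{v, u}"] that by auto
  have g: "graph_on {..<n} E'" using E(1) S(1) \<open>v < n\<close> unfolding graph_on_def E'_def by auto
  have deg: "degree E' i = degree E i + (if i = v then card ?S else of_bool (i \<in> ?S))" for i
  proof -
    have fin: "finite (nbrs E i)" using nbrs_subset[OF E(1), of i] finite_subset by blast
    have "card (nbrs E' i) = card (nbrs E i) + (if i = v then card ?S else of_bool (i \<in> ?S))"
    proof (cases "i = v")
      case True
      have "nbrs E' v = nbrs E v \<union> ?S" using S(1) by (auto simp: nbrs_def edge)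
      moreover have "nbrs E v \<inter> ?S = {}" using new S(1) by (force simp: nbrs_def)
      ultimately show ?thesis using fin finite_selected True by (simp add: card_Un_disjoint)
    next
      case False
      then have "nbrs E' i = (if i \<in> ?S then insert v (nbrs E i) else nbrs E i)"
        by (auto simp: nbrs_def edge)
      moreover have "v \<notin> nbrs E i" if "i \<in> ?S"
        using new[of i] S(1) that by (auto simp: nbrs_def insert_commute)
      ultimately show ?thesis using fin False by simp
    qed
    then show ?thesis using degree_eq_card_nbrs[OF E(1)] degree_eq_card_nbrs[OF g] by simp
  qed
  have "?r i + degree E' i = d i" if "i < n" for i
    using deg[of i] E(3)[OF that] card_selected_le[of n m v r] S(2)[of i]
    by (auto simp: residual_def)
  moreover have "\<exists>i\<in>e. i < Suc v" if "e \<in> E'" for e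
    using that E(2)[of e] less_SucI unfolding E'_def by blast
  moreover have A'E: "A' i j = of_bool ({i, j} \<in> E')" if "i < n" "j < n" "i < Suc v \<or> j < Suc v" for i j
  proof -
    have "{i, i} \<notin> E" "{i, i} \<notin> E'" for i
      using graph_on_edge(1)[OF E(1)] graph_on_edge(1)[OF g] by blast+
    then show ?thesis
      using A'[OF that(1,2)] that E(4)[OF that(1,2)] new[of i] new[of j] S(1) diag
      by (cases i v rule: linorder_cases; cases j v rule: linorder_cases)
        (auto simp: edge insert_commute)
  qed
  moreover have "?r i = 0 \<and> (i < m \<longrightarrow> {i, 2 * m - 1 - i} \<in> E')" if "bad' = 0" "i < Suc v" for i
  proof (cases "i = v")
    case True
    then show ?thesis using that bad' A'E[of v "2 * m - 1 - v"] assms(2,3) by (auto split: if_splits)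
  next
    case False
    then show ?thesis using that bad' E(5)[of i] E(6)[of i] by (auto simp: residual_def E'_def split: if_splits)
  qed
  moreover have "bad' = 0 \<and> feasible n m (Suc v) ?r \<and> block_sorted m (Suc v) ?r" if "feasible n m 0 d"
  proof -
    note f = feas[OF that]
    have "\<forall>i<n. r i < n" using E(3) d by (metis le_add1 le_less_trans)
    note step = residual_feasible[OF _ _ assms(2,3) this] mate_selected[OF _ assms(3) _ _ this]
    have "?r v = 0" using step(1) f by (simp add: residual_def)
    moreover have "A' v (2 * m - 1 - v) \<noteq> 0" if "v < m"
      using step(3)[OF that] feasible_pos[OF _ that] f A'[of v "2 * m - 1 - v"] assms(2,3) S(1) that by force
    ultimately show ?thesis using f step(2) residual_sorted[OF _ assms(3)] bad' by auto
  qed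
  ultimately show ?thesis unfolding rows_done_def using g by blast
qed

text \<open>\<open>A\<close> is arbitrary: with no row done, entries left over from a run with
  larger \<open>m\<close> do no harm.\<close>

lemma rows_done_init:
  assumes "sorted_wrt (\<ge>) d" "2 * m \<le> length d"
  shows "rows_done (length d) m 0 ((!) d) ((!) d) A 0"
proof -
  have "block_sorted m 0 ((!) d)"
    unfolding block_sorted_def
  proof (intro ballI impI)
    fix i j assume "i \<in> block m 0" "j \<in> block m 0" "i \<le> j"
    then show "d ! j \<le> d ! i"
      using assms sorted_wrt_nth_less[OF assms(1), of i j] by (cases "i = j") (auto simp: block_def)
  qed
  then show ?thesis unfolding rows_done_def
    by (intro conjI exI[of _ "{}"]) (auto simp: graph_on_def degree_def)
qed

text \<open>The second part is the certificate: residual degrees have vanished, and the pairs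
  \<open>i\<close>, \<open>2 * m - 1 - i\<close> with \<open>i < m\<close> are disjoint
  edges.\<close>

lemma rows_done_final:
  assumes "rows_done (length d) m (length d) ((!) d) r A bad" "2 * m \<le> length d"
  shows "feasible (length d) m 0 ((!) d) \<Longrightarrow> bad = 0"
    and "bad = 0 \<Longrightarrow> \<exists>E M. realizes d E \<and> matching E M \<and> card M = m \<and>
      (\<forall>i<length d. \<forall>j<length d. A i j = of_bool ({i, j} \<in> E))"
proof -
  show "bad = 0" if "feasible (length d) m 0 ((!) d)" using assms that by (auto simp: rows_done_def)
  assume "bad = 0"
  then obtain E where E: "graph_on {..<length d} E" "\<And>i. i < length d \<Longrightarrow> degree E i = d ! i"
    "\<And>i. i < m \<Longrightarrow> {i, 2 * m - 1 - i} \<in> E"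
    "\<forall>i<length d. \<forall>j<length d. A i j = of_bool ({i, j} \<in> E)"
    using assms unfolding rows_done_def by auto
  let ?M = "(\<lambda>i. {i, 2 * m - 1 - i}) ` {..<m}"
  have "matching E ?M" using E(3) by (auto simp: matching_def pairwise_def disjnt_def)
  moreover have "card ?M = m"
    by (subst card_image) (auto simp: inj_on_def doubleton_eq_iff)
  ultimately show "\<exists>E M. realizes d E \<and> matching E M \<and> card M = m \<and>
      (\<forall>i<length d. \<forall>j<length d. A i j = of_bool ({i, j} \<in> E))"
    using E by (auto simp: realizes_graph_on)
qed

text \<open>Justifies counting instead of sorting: \<open>t\<close> is the key at which the quota
  \<open>r v\<close> runs out, and \<open>k\<close> is what is left of it there. Larger keys fit
  entirely, smaller ones not at all, and within key \<open>t\<close> large indices come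
  first.\<close>

lemma selected_threshold:
  assumes t: "t = 0 \<or> r v \<le> card {i\<in>{v<..<n}. t \<le> key n m v r i}"
    and k: "k + card {i\<in>{v<..<n}. t < key n m v r i} = r v" and j: "j \<in> {v<..<n}"
  shows "j \<in> selected n m v r \<longleftrightarrow> t < key n m v r j \<or>
    key n m v r j = t \<and> 0 < t \<and> card {i\<in>{j<..<n}. key n m v r i = t} < k"
proof -
  let ?K = "key n m v r" and ?V = "{v<..<n}"
  have fin: "finite {i\<in>?V. Q i}" for Q by simp
  have pos: "0 < r j \<longleftrightarrow> 0 < ?K j" using j by (auto simp: key_def)
  have sel: "j \<in> selected n m v r \<longleftrightarrow> 0 < ?K j \<and> card (preceding n m v r j) < r v"
    using j pos by (simp add: selected_def)
  consider "t < ?K j" | "?K j < t" | "?K j = t" by linarith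
  then show ?thesis
  proof cases
    case 1
    have "preceding n m v r j \<subset> {i\<in>?V. t < ?K i}"
      using 1 j by (auto simp: preceding_def psubset_eq)
    then have "card (preceding n m v r j) < card {i\<in>?V. t < ?K i}" by (intro psubset_card_mono fin)
    with 1 k sel show ?thesis by auto
  next
    case 2
    then have "{i\<in>?V. t \<le> ?K i} \<subseteq> preceding n m v r j" by (auto simp: preceding_def)
    then have "card {i\<in>?V. t \<le> ?K i} \<le> card (preceding n m v r j)"
      by (intro card_mono) (auto simp: preceding_def)
    with 2 t sel show ?thesis by auto
  next
    case 3
    have "preceding n m v r j = {i\<in>?V. t < ?K i} \<union> {i\<in>{j<..<n}. ?K i = t}"
      using 3 j by (auto simp: preceding_def)
    then have "card (preceding n m v r j) = card {i\<in>?V. t < ?K i} + card {i\<in>{j<..<n}. ?K i = t}"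
      by (simp add: card_Un_disjoint disjoint_iff)
    with 3 k sel show ?thesis by auto
  qed
qed

section \<open>Total correctness with time bounds\<close>

text \<open>Total correctness including the absence of overflow, since a stuck program has no
  execution.\<close>

definition wp :: "nat \<Rightarrow> com \<Rightarrow> nat \<Rightarrow> (state \<Rightarrow> bool) \<Rightarrow> state \<Rightarrow> bool" where
  "wp W c T Q s \<longleftrightarrow> (\<exists>t s'. exec W c s t s' \<and> t \<le> T \<and> Q s')"

lemma wp_mono:
  assumes "wp W c T Q s" "T \<le> T'" "\<And>s. Q s \<Longrightarrow> Q' s"
  shows "wp W c T' Q' s"
  using assms unfolding wp_def by (meson le_trans)

lemma wp_seq:
  assumes "wp W a T1 R s" "\<And>s. R s \<Longrightarrow> wp W b T2 Q s" "T1 + T2 \<le> T"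
  shows "wp W (Seq a b) T Q s"
proof -
  obtain t s' where 1: "exec W a s t s'" "t \<le> T1" "R s'" using assms(1) by (auto simp: wp_def)
  obtain u s'' where 2: "exec W b s' u s''" "u \<le> T2" "Q s''" using assms(2)[OF 1(3)] by (auto simp: wp_def)
  from exec.Seq[OF 1(1) 2(1)] 1 2 assms(3) show ?thesis unfolding wp_def
    by (intro exI[of _ "t + u"] exI[of _ s'']) simp
qed

text \<open>\<open>f\<close> bounds the number of rounds; the extra 1 in \<open>f s + 1\<close> pays
  for the final failing test.\<close>

lemma wp_while:
  fixes f :: "state \<Rightarrow> nat"
  assumes "I s" and fits: "\<And>s. I s \<Longrightarrow> bfits W b s"
    and step: "\<And>s. I s \<Longrightarrow> bval b s \<Longrightarrow> wp W c T (\<lambda>s'. I s' \<and> f s' < f s) s"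
    and exit: "\<And>s. I s \<Longrightarrow> \<not> bval b s \<Longrightarrow> Q s"
    and "(f s + 1) * (bcost b + 1 + T) \<le> T'"
  shows "wp W (While b c) T' Q s"
proof -
  have "wp W (While b c) ((f s + 1) * (bcost b + 1 + T)) Q s" using \<open>I s\<close>
  proof (induction "f s" arbitrary: s rule: less_induct)
    case less
    show ?case
    proof (cases "bval b s")
      case False
      from exec.WhileFalse[OF fits[OF less.prems] this, of c] exit[OF less.prems False]
      show ?thesis unfolding wp_def by (intro exI[of _ "bcost b + 1"] exI[of _ s]) simp
    next
      case True
      from step[OF less.prems True] obtain t s' where
        1: "exec W c s t s'" "t \<le> T" "I s'" "f s' < f s" by (auto simp: wp_def)
      from less.hyps[OF 1(4,3)] obtain u s'' where
        2: "exec W (While b c) s' u s''" "u \<le> (f s' + 1) * (bcost b + 1 + T)" "Q s''"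
        by (auto simp: wp_def)
      have "(f s' + 2) * (bcost b + 1 + T) \<le> (f s + 1) * (bcost b + 1 + T)"
        using 1(4) by (intro mult_right_mono) auto
      then have "bcost b + 1 + t + u \<le> (f s + 1) * (bcost b + 1 + T)"
        using 1(2) 2(2) by (simp add: algebra_simps)
      with exec.WhileTrue[OF fits[OF less.prems] True 1(1) 2(1)] 2(3)
      show ?thesis unfolding wp_def by blast
    qed
  qed
  then show ?thesis using assms(5) by (rule wp_mono)
qed

section \<open>Symbolic execution of loop-free code\<close>

fun loop_free :: "com \<Rightarrow> bool" where
  "loop_free (Seq P Q) \<longleftrightarrow> loop_free P \<and> loop_free Q"
| "loop_free (Cond b P Q) \<longleftrightarrow> loop_free P \<and> loop_free Q"
| "loop_free (While b P) \<longleftrightarrow> False"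
| "loop_free _ \<longleftrightarrow> True"

fun run :: "com \<Rightarrow> state \<Rightarrow> state" where
  "run (Assign x a) s = s\<lparr>var := (var s)(x := aval a s)\<rparr>"
| "run (Store A i a) s = s\<lparr>arr := (arr s)(A := (arr s A)(aval i s := aval a s))\<rparr>"
| "run (Seq P Q) s = run Q (run P s)"
| "run (Cond b P Q) s = (if bval b s then run P s else run Q s)"
| "run _ s = s"

fun cfits :: "nat \<Rightarrow> com \<Rightarrow> state \<Rightarrow> bool" where
  "cfits W (Assign x a) s \<longleftrightarrow> afits W a s"
| "cfits W (Store A i a) s \<longleftrightarrow> afits W i s \<and> afits W a s"
| "cfits W (Seq P Q) s \<longleftrightarrow> cfits W P s \<and> cfits W Q (run P s)"
| "cfits W (Cond b P Q) s \<longleftrightarrow> bfits W b s \<and> (if bval b s then cfits W P s else cfits W Q s)"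
| "cfits W _ s \<longleftrightarrow> True"

text \<open>Adding the costs of both branches overestimates, but makes the bound independent of the
  state.\<close>

fun ccost :: "com \<Rightarrow> nat" where
  "ccost (Assign x a) = acost a + 1"
| "ccost (Store A i a) = acost i + acost a + 1"
| "ccost (Seq P Q) = ccost P + ccost Q"
| "ccost (Cond b P Q) = bcost b + 1 + (ccost P + ccost Q)"
| "ccost _ = 1"

lemma exec_run:
  "loop_free c \<Longrightarrow> cfits W c s \<Longrightarrow> \<exists>t\<le>ccost c. exec W c s t (run c s)"
proof (induction c arbitrary: s)
  case Skip
  show ?case using exec.Skip by auto
next
  case (Assign x a)
  then show ?case using exec.Assign by auto
next
  case (Store A i a)
  then show ?case using exec.Store by auto
next
  case (Seq P Q)
  obtain t where t: "t \<le> ccost P" "exec W P s t (run P s)" using Seq by auto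
  obtain u where u: "u \<le> ccost Q" "exec W Q (run P s) u (run Q (run P s))" using Seq by auto
  from exec.Seq[OF t(2) u(2)] t(1) u(1) show ?case by (intro exI[of _ "t + u"]) auto
next
  case (Cond b P Q)
  show ?case
  proof (cases "bval b s")
    case True
    with Cond obtain t where "t \<le> ccost P" "exec W P s t (run P s)" by auto
    with exec.CondTrue[OF _ True this(2)] Cond.prems True show ?thesis
      by (intro exI[of _ "bcost b + 1 + t"]) auto
  next
    case False
    with Cond obtain t where "t \<le> ccost Q" "exec W Q s t (run Q s)" by auto
    with exec.CondFalse[OF _ False this(2)] Cond.prems False show ?thesis
      by (intro exI[of _ "bcost b + 1 + t"]) auto
  qed
qed simp

lemma wp_run:
  assumes "loop_free c" "cfits W c s" "ccost c \<le> T" "Q (run c s)"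
  shows "wp W c T Q s"
  using exec_run[OF assms(1,2)] assms(3,4) unfolding wp_def by (meson le_trans)

definition same_except :: "string set \<Rightarrow> string set \<Rightarrow> state \<Rightarrow> state \<Rightarrow> bool" where
  "same_except X Y s s' \<longleftrightarrow> (\<forall>x. x \<notin> X \<longrightarrow> var s' x = var s x) \<and> (\<forall>A. A \<notin> Y \<longrightarrow> arr s' A = arr s A)"

lemma same_except_refl: "same_except X Y s s"
  by (simp add: same_except_def)

lemma same_except_trans:
  "same_except X Y s s' \<Longrightarrow> same_except X' Y' s' s'' \<Longrightarrow> X \<subseteq> Z \<Longrightarrow> X' \<subseteq> Z \<Longrightarrow> Y \<subseteq> Z' \<Longrightarrow> Y' \<subseteq> Z' \<Longrightarrow>
    same_except Z Z' s s''"
  unfolding same_except_def by (metis subsetD)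

lemma same_exceptD:
  assumes "same_except X Y s s'"
  shows "x \<notin> X \<Longrightarrow> var s' x = var s x" "A \<notin> Y \<Longrightarrow> arr s' A = arr s A"
  using assms by (auto simp: same_except_def)

section \<open>Initialization of arrays in linear time\<close>

definition "u_next = Assign ''u'' (Plus (Var ''u'') (Const 1))"

definition "copy_degrees = Seq (Assign ''u'' (Const 0))
  (While (Less (Var ''u'') (Var ''n''))
    (Seq (Store ''r'' (Var ''u'') (Elem ''d'' (Var ''u''))) u_next))"

lemma copy_degrees:
  assumes "var s ''n'' = n" "\<And>i. i < n \<Longrightarrow> arr s ''d'' i < W" "n + 1 < W" "14 * (n + 1) \<le> T"
  shows "wp W copy_degrees T (\<lambda>s'. same_except {''u''} {''r''} s s' \<and>
    (\<forall>i<n. arr s' ''r'' i = arr s ''d'' i)) s"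
  unfolding copy_degrees_def
proof (rule wp_seq[where R = "\<lambda>s'. same_except {''u''} {''r''} s s' \<and> var s' ''u'' = 0"
      and ?T1.0 = 2 and ?T2.0 = "(n + 1) * 12"])
  fix s1 assume s1: "same_except {''u''} {''r''} s s1 \<and> var s1 ''u'' = 0"
  let ?I = "\<lambda>s'. same_except {''u''} {''r''} s s' \<and> var s' ''u'' \<le> n \<and>
    (\<forall>i<var s' ''u''. arr s' ''r'' i = arr s ''d'' i)"
  show "wp W (While (Less (Var ''u'') (Var ''n''))
    (Seq (Store ''r'' (Var ''u'') (Elem ''d'' (Var ''u''))) u_next)) ((n + 1) * 12)
    (\<lambda>s'. same_except {''u''} {''r''} s s' \<and> (\<forall>i<n. arr s' ''r'' i = arr s ''d'' i)) s1"
  \<comment> \<open>The body costs 8 and each test with its branch 4, which gives the 12 per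
    round.\<close>
  proof (rule wp_while[where I = ?I and f = "\<lambda>s'. n - var s' ''u''" and T = 8])
    fix s2 assume I: "?I s2" and b: "bval (Less (Var ''u'') (Var ''n'')) s2"
    note eq = same_exceptD[OF conjunct1[OF I]]
    show "wp W (Seq (Store ''r'' (Var ''u'') (Elem ''d'' (Var ''u''))) u_next) 8
      (\<lambda>s'. ?I s' \<and> n - var s' ''u'' < n - var s2 ''u'') s2"
      using I b assms
      by (intro wp_run) (auto simp: u_next_def eq same_except_def less_Suc_eq)
  qed (use s1 assms in \<open>auto simp: same_except_def\<close>)
qed (use assms in \<open>auto intro!: wp_run simp: same_except_def\<close>)

text \<open>Keys range from 0 to \<open>2 * n\<close>, hence \<open>2 * n + 1\<close>
  counters.\<close>

definition "clear_counts = Seq (Assign ''u'' (Const 0))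
  (While (Less (Var ''u'') (Plus (Times (Const 2) (Var ''n'')) (Const 1)))
    (Seq (Store ''cnt'' (Var ''u'') (Const 0)) u_next))"

lemma clear_counts:
  assumes "var s ''n'' = n" "2 * n + 2 < W" "32 * (n + 1) \<le> T"
  shows "wp W clear_counts T (\<lambda>s'. same_except {''u''} {''cnt''} s s' \<and>
    (\<forall>i\<le>2*n. arr s' ''cnt'' i = 0)) s"
  unfolding clear_counts_def
proof (rule wp_seq[where R = "\<lambda>s'. same_except {''u''} {''cnt''} s s' \<and> var s' ''u'' = 0"
      and ?T1.0 = 2 and ?T2.0 = "(2 * n + 2) * 15"])
  fix s1 assume s1: "same_except {''u''} {''cnt''} s s1 \<and> var s1 ''u'' = 0"
  let ?I = "\<lambda>s'. same_except {''u''} {''cnt''} s s' \<and> var s' ''u'' \<le> 2 * n + 1 \<and>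
    (\<forall>i<var s' ''u''. arr s' ''cnt'' i = 0)"
  show "wp W (While (Less (Var ''u'') (Plus (Times (Const 2) (Var ''n'')) (Const 1)))
    (Seq (Store ''cnt'' (Var ''u'') (Const 0)) u_next)) ((2 * n + 2) * 15)
    (\<lambda>s'. same_except {''u''} {''cnt''} s s' \<and> (\<forall>i\<le>2*n. arr s' ''cnt'' i = 0)) s1"
  proof (rule wp_while[where I = ?I and f = "\<lambda>s'. 2 * n + 1 - var s' ''u''" and T = 7])
    fix s2 assume I: "?I s2" and b: "bval (Less (Var ''u'') (Plus (Times (Const 2) (Var ''n'')) (Const 1))) s2"
    note eq = same_exceptD[OF conjunct1[OF I]]
    show "wp W (Seq (Store ''cnt'' (Var ''u'') (Const 0)) u_next) 7
      (\<lambda>s'. ?I s' \<and> 2 * n + 1 - var s' ''u'' < 2 * n + 1 - var s2 ''u'') s2"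
      using I b assms
      by (intro wp_run) (auto simp: u_next_def eq same_except_def less_Suc_eq)
  qed (use s1 assms in \<open>auto simp: same_except_def\<close>)
qed (use assms in \<open>auto intro!: wp_run simp: same_except_def\<close>)

section \<open>The program\<close>

definition "compute_key =
  Cond (Eq (Elem ''r'' (Var ''u'')) (Const 0)) (Assign ''x'' (Const 0))
    (Cond (Eq (Plus (Plus (Var ''u'') (Var ''v'')) (Const 1)) (Times (Const 2) (Var ''m'')))
      (Assign ''x'' (Times (Const 2) (Var ''n'')))
      (Cond (Less (Plus (Var ''u'') (Var ''v'')) (Times (Const 2) (Var ''m'')))
        (Assign ''x'' (Times (Const 2) (Elem ''r'' (Var ''u''))))
        (Assign ''x'' (Plus (Times (Const 2) (Elem ''r'' (Var ''u''))) (Const 1)))))"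

definition "store_key = Seq compute_key
  (Seq (Store ''key'' (Var ''u'') (Var ''x''))
  (Seq (Store ''cnt'' (Var ''x'') (Plus (Elem ''cnt'' (Var ''x'')) (Const 1))) u_next))"

definition "store_keys = Seq (Assign ''u'' (Plus (Var ''v'') (Const 1)))
  (While (Less (Var ''u'') (Var ''n'')) store_key)"

text \<open>In the word bound, \<open>n * n\<close> makes room for matrix indices and
  \<open>4 * n + 10\<close>, with slack, for keys, counters and loop bounds.\<close>

context
  fixes n m v W :: nat and r :: "nat \<Rightarrow> nat"
  assumes v: "v < n" and m: "2 * m \<le> n" and W: "n * n + 4 * n + 10 \<le> W"
    and r_bound: "\<forall>i<n. r i < n"
begin

private lemmas r = r_bound[rule_format]

private abbreviation "K \<equiv> key n m v r"

lemma key_le: "i < n \<Longrightarrow> K i \<le> 2 * n"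
  using r[of i] by (auto simp: key_def)

definition row_vars :: "state \<Rightarrow> bool" where
  "row_vars s \<longleftrightarrow> var s ''n'' = n \<and> var s ''m'' = m \<and> var s ''v'' = v"

lemma store_keys:
  assumes "row_vars s" "\<forall>i<n. arr s ''r'' i = r i" "\<forall>i\<le>2*n. arr s ''cnt'' i = 0" "80 * (n + 1) \<le> T"
  shows "wp W store_keys T (\<lambda>s'. same_except {''u'', ''x''} {''key'', ''cnt''} s s' \<and>
    (\<forall>i. v < i \<and> i < n \<longrightarrow> arr s' ''key'' i = K i) \<and>
    (\<forall>t\<le>2*n. arr s' ''cnt'' t = card {i\<in>{v<..<n}. K i = t})) s"
  unfolding store_keys_def
proof (rule wp_seq[where R = "\<lambda>s'. same_except {''u'', ''x''} {''key'', ''cnt''} s s' \<and> var s' ''u'' = v + 1 \<and>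
        (\<forall>i\<le>2*n. arr s' ''cnt'' i = 0)"
      and ?T1.0 = 4 and ?T2.0 = "(n + 1) * 70"])
  fix s1 assume s1: "same_except {''u'', ''x''} {''key'', ''cnt''} s s1 \<and> var s1 ''u'' = v + 1 \<and>
        (\<forall>i\<le>2*n. arr s1 ''cnt'' i = 0)"
  let ?I = "\<lambda>s'. same_except {''u'', ''x''} {''key'', ''cnt''} s s' \<and> v < var s' ''u'' \<and> var s' ''u'' \<le> n \<and>
    (\<forall>i. v < i \<and> i < var s' ''u'' \<longrightarrow> arr s' ''key'' i = K i) \<and>
    (\<forall>t\<le>2*n. arr s' ''cnt'' t = card {i\<in>{v<..<var s' ''u''}. K i = t})"
  show "wp W (While (Less (Var ''u'') (Var ''n'')) store_key) ((n + 1) * 70)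
    (\<lambda>s'. same_except {''u'', ''x''} {''key'', ''cnt''} s s' \<and>
    (\<forall>i. v < i \<and> i < n \<longrightarrow> arr s' ''key'' i = K i) \<and>
    (\<forall>t\<le>2*n. arr s' ''cnt'' t = card {i\<in>{v<..<n}. K i = t})) s1"
  proof (rule wp_while[where I = ?I and f = "\<lambda>s'. n - var s' ''u''" and T = 66])
    fix s2 assume I: "?I s2" and b: "bval (Less (Var ''u'') (Var ''n'')) s2"
    note eq = same_exceptD[OF conjunct1[OF I]]
    define u where "u = var s2 ''u''"
    have vars: "var s2 ''n'' = n" "var s2 ''m'' = m" "var s2 ''v'' = v" and u: "v < u" "u < n"
      using assms(1) I b by (auto simp: eq row_vars_def u_def)
    have ru: "arr s2 ''r'' u = r u" "r u < n" using assms(2) u r by (auto simp: eq)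
    have key: "run compute_key s2 = s2\<lparr>var := (var s2)(''x'' := K u)\<rparr>"
      by (simp add: compute_key_def u_def[symmetric] vars ru key_def)
    have key_fits: "cfits W compute_key s2"
      using W u m ru(2) by (simp add: compute_key_def u_def[symmetric] vars ru(1))
    have "card {i\<in>{v<..<u}. K i = t} \<le> card {v<..<u}" for t by (intro card_mono) auto
    moreover have "card {v<..<u} < n" using u by simp
    ultimately have cnt_less: "card {i\<in>{v<..<u}. K i = t} < n" for t by (rule le_less_trans)
    have "\<forall>t\<le>2*n. arr s2 ''cnt'' t = card {i\<in>{v<..<u}. K i = t}"
      unfolding u_def using I by blast
    then have cnt: "arr s2 ''cnt'' t = card {i\<in>{v<..<u}. K i = t}" "card {i\<in>{v<..<u}. K i = t} < n"
      if "t \<le> 2 * n" for t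
      using that cnt_less by blast+
    have split: "{i\<in>{v<..<Suc u}. K i = t} = (if K u = t then insert u {i\<in>{v<..<u}. K i = t}
       else {i\<in>{v<..<u}. K i = t})" for t
      using u by (auto simp: less_Suc_eq)
    have Ku: "K u \<le> 2 * n" using key_le u by simp
    let ?s = "s2\<lparr>var := (var s2)(''x'' := K u, ''u'' := u + 1),
       arr := (arr s2)(''key'' := (arr s2 ''key'')(u := K u),
         ''cnt'' := (arr s2 ''cnt'')(K u := arr s2 ''cnt'' (K u) + 1))\<rparr>"
    have run: "run store_key s2 = ?s"
      by (simp add: store_key_def u_next_def key u_def[symmetric])
    have "arr s2 ''cnt'' (K u) < n" unfolding cnt(1)[OF Ku] by (rule cnt_less)
    then have fits: "cfits W store_key s2"
      using W u Ku by (simp add: store_key_def u_next_def key key_fits u_def[symmetric])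
    have sz: "card {i\<in>{v<..<Suc u}. K i = t} = card {i\<in>{v<..<u}. K i = t} + of_bool (K u = t)" for t
      unfolding split by simp
    have "arr ?s ''cnt'' t = card {i\<in>{v<..<Suc u}. K i = t}" if "t \<le> 2 * n" for t
      unfolding sz using cnt(1)[OF that] by auto
    moreover have "same_except {''u'', ''x''} {''key'', ''cnt''} s ?s"
      using conjunct1[OF I] by (simp add: same_except_def)
    moreover have "\<forall>i. v < i \<and> i < Suc u \<longrightarrow> arr ?s ''key'' i = K i"
      using I unfolding u_def[symmetric] by (auto simp: less_Suc_eq)
    ultimately have "?I ?s" using u by simp
    then have post: "?I (run store_key s2) \<and> n - var (run store_key s2) ''u'' < n - var s2 ''u''"
      unfolding run using u by (simp add: u_def[symmetric])
    have "loop_free store_key" "ccost store_key \<le> 66"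
      by (simp_all add: store_key_def compute_key_def u_next_def)
    then show "wp W store_key 66 (\<lambda>s'. ?I s' \<and> n - var s' ''u'' < n - var s2 ''u'') s2"
      using post by (rule wp_run[OF _ fits])
  qed (use s1 assms(1) v W in \<open>auto simp: same_except_def row_vars_def\<close>)
qed (use assms v W in \<open>auto intro!: wp_run simp: same_except_def row_vars_def\<close>)

text \<open>Walks down the buckets and spends the quota \<open>r v\<close>, stopping at the first
  bucket that absorbs the rest, or at bucket 0, from which nothing is ever taken.\<close>

definition "find_threshold = Seq (Assign ''t'' (Times (Const 2) (Var ''n'')))
  (Seq (Assign ''k'' (Elem ''r'' (Var ''v'')))
  (While (BAnd (Less (Const 0) (Var ''t'')) (Less (Elem ''cnt'' (Var ''t'')) (Var ''k'')))
    (Seq (Assign ''k'' (Minus (Var ''k'') (Elem ''cnt'' (Var ''t''))))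
      (Assign ''t'' (Minus (Var ''t'') (Const 1))))))"

text \<open>The situation at loop exit, in the form that \<open>selected_threshold\<close>
  consumes.\<close>

definition threshold :: "nat \<Rightarrow> nat \<Rightarrow> bool" where
  "threshold t k \<longleftrightarrow> t \<le> 2 * n \<and> k + card {i\<in>{v<..<n}. t < K i} = r v \<and>
    (t = 0 \<or> r v \<le> card {i\<in>{v<..<n}. t \<le> K i})"

lemma find_threshold:
  assumes "row_vars s" "\<forall>i<n. arr s ''r'' i = r i"
    "\<forall>t\<le>2*n. arr s ''cnt'' t = card {i\<in>{v<..<n}. K i = t}" "60 * (n + 1) \<le> T"
  shows "wp W find_threshold T (\<lambda>s'. same_except {''t'', ''k''} {} s s' \<and>
    threshold (var s' ''t'') (var s' ''k'')) s"
  unfolding find_threshold_def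
proof (rule wp_seq[where R = "\<lambda>s'. same_except {''t'', ''k''} {} s s' \<and> var s' ''t'' = 2 * n"
      and ?T1.0 = 4 and ?T2.0 = "(2 * n + 1) * 23 + 3"])
  fix s1 assume s1: "same_except {''t'', ''k''} {} s s1 \<and> var s1 ''t'' = 2 * n"
  let ?b = "BAnd (Less (Const 0) (Var ''t'')) (Less (Elem ''cnt'' (Var ''t'')) (Var ''k''))"
  let ?c = "Seq (Assign ''k'' (Minus (Var ''k'') (Elem ''cnt'' (Var ''t''))))
      (Assign ''t'' (Minus (Var ''t'') (Const 1)))"
  let ?I = "\<lambda>s'. same_except {''t'', ''k''} {} s s' \<and> var s' ''t'' \<le> 2 * n \<and>
    var s' ''k'' + card {i\<in>{v<..<n}. var s' ''t'' < K i} = r v"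
  have split: "card {i\<in>{v<..<n}. t \<le> K i} = card {i\<in>{v<..<n}. K i = t} + card {i\<in>{v<..<n}. t < K i}" for t
  proof -
    have "{i\<in>{v<..<n}. t \<le> K i} = {i\<in>{v<..<n}. K i = t} \<union> {i\<in>{v<..<n}. t < K i}" by auto
    then show ?thesis by (simp add: card_Un_disjoint disjoint_iff)
  qed
  have "card {i\<in>{v<..<n}. K i = t} \<le> card {v<..<n}" for t by (intro card_mono) auto
  moreover have "card {v<..<n} < n" using v by simp
  ultimately have cnt: "card {i\<in>{v<..<n}. K i = t} < n" for t by (rule le_less_trans)
  have cntW: "card {i\<in>{v<..<n}. K i = t} < W" for t using cnt[of t] W by linarith
  have rv: "r v < W" using r[OF v] W by linarith
  show "wp W (Seq (Assign ''k'' (Elem ''r'' (Var ''v''))) (While ?b ?c)) ((2 * n + 1) * 23 + 3)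
    (\<lambda>s'. same_except {''t'', ''k''} {} s s' \<and> threshold (var s' ''t'') (var s' ''k'')) s1"
  proof (rule wp_seq[where R = ?I and ?T1.0 = 3 and ?T2.0 = "(2 * n + 1) * 23"])
    have "\<not> 2 * n < K i" if "i \<in> {v<..<n}" for i using key_le[of i] that by simp
    then have "{i\<in>{v<..<n}. 2 * n < K i} = {}" by blast
    then have "card {i\<in>{v<..<n}. 2 * n < K i} = 0" by simp
    then show "wp W (Assign ''k'' (Elem ''r'' (Var ''v''))) 3 ?I s1"
      using s1 assms(1,2) v rv W by (intro wp_run) (auto simp: same_except_def row_vars_def)
    fix s2 assume I2: "?I s2"
    then have le: "(var s2 ''t'' + 1) * 23 \<le> (2 * n + 1) * 23" by (intro mult_right_mono) auto
    show "wp W (While ?b ?c) ((2 * n + 1) * 23)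
      (\<lambda>s'. same_except {''t'', ''k''} {} s s' \<and> threshold (var s' ''t'') (var s' ''k'')) s2"
    proof (rule wp_while[where I = ?I and f = "\<lambda>s'. var s' ''t''" and T = 9])
      fix s3 assume I: "?I s3"
      note eq = same_exceptD[OF conjunct1[OF I]]
      have k: "var s3 ''k'' < W" using I rv by linarith
      have arr: "arr s3 ''cnt'' (var s3 ''t'') = card {i\<in>{v<..<n}. K i = var s3 ''t''}"
        using assms(3) I by (simp add: eq)
      show "bfits W ?b s3" using k I W cntW by (simp add: arr)
      show "same_except {''t'', ''k''} {} s s3 \<and> threshold (var s3 ''t'') (var s3 ''k'')"
        if "\<not> bval ?b s3"
        using I that split[of "var s3 ''t''"] by (auto simp: threshold_def arr)
      assume b: "bval ?b s3"
      have "{i\<in>{v<..<n}. var s3 ''t'' - 1 < K i} = {i\<in>{v<..<n}. var s3 ''t'' \<le> K i}"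
        using b by auto
      \<comment> \<open>The loop test guarantees that the counter is below \<open>k\<close>, so the
        subtraction is not truncated.\<close>
      then have sum: "var s3 ''k'' - card {i\<in>{v<..<n}. K i = var s3 ''t''}
          + card {i\<in>{v<..<n}. var s3 ''t'' - 1 < K i} = r v"
        using I b split[of "var s3 ''t''"] by (simp add: arr)
      define c where "c = card {i\<in>{v<..<n}. K i = var s3 ''t''}"
      have run: "run ?c s3 = s3\<lparr>var := (var s3)(''k'' := var s3 ''k'' - c, ''t'' := var s3 ''t'' - 1)\<rparr>"
        by (simp add: arr c_def)
      have fits: "cfits W ?c s3" using k I W cntW[of "var s3 ''t''"] by (simp add: arr)
      have same: "same_except {''t'', ''k''} {} s (run ?c s3)"
        unfolding run using conjunct1[OF I] by (simp add: same_except_def)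
      show "wp W ?c 9 (\<lambda>s'. ?I s' \<and> var s' ''t'' < var s3 ''t'') s3"
      proof (rule wp_run)
        show "?I (run ?c s3) \<and> var (run ?c s3) ''t'' < var s3 ''t''"
          using same sum I b unfolding run c_def by auto
      qed (use fits in simp_all)
    next
      show "?I s2" by (fact I2)
      show "(var s2 ''t'' + 1) * (bcost ?b + 1 + 9) \<le> (2 * n + 1) * 23" using le by simp
    qed
  qed simp
qed (use assms(1,4) W in \<open>auto intro!: wp_run simp: same_except_def row_vars_def\<close>)

section \<open>Writing one row of the matrix\<close>

definition "idx a b = Plus (Times (Var a) (Var ''n'')) (Var b)"

text \<open>\<open>k\<close> drops at every vertex of key \<open>t\<close>, chosen or not, and
  truncation then holds it at 0. It is assigned in both branches, so that either way the step ends
  in an update of \<open>k\<close>.\<close>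

definition "choose_next = Seq
  (Cond (Less (Var ''t'') (Elem ''key'' (Var ''u''))) (Assign ''x'' (Const 1))
    (Cond (BAnd (Eq (Elem ''key'' (Var ''u'')) (Var ''t''))
        (BAnd (Less (Const 0) (Var ''t'')) (Less (Const 0) (Var ''k''))))
      (Assign ''x'' (Const 1)) (Assign ''x'' (Const 0))))
  (Cond (Eq (Elem ''key'' (Var ''u'')) (Var ''t''))
      (Assign ''k'' (Minus (Var ''k'') (Const 1))) (Assign ''k'' (Var ''k'')))"

definition "select_next = Seq (Assign ''u'' (Minus (Var ''u'') (Const 1)))
  (Seq choose_next
  (Seq (Store ''adj'' (idx ''v'' ''u'') (Var ''x''))
  (Seq (Store ''adj'' (idx ''u'' ''v'') (Var ''x''))
  (Seq (Store ''r'' (Var ''u'') (Minus (Elem ''r'' (Var ''u'')) (Var ''x'')))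
    (Store ''r'' (Var ''v'') (Minus (Elem ''r'' (Var ''v'')) (Var ''x'')))))))"

text \<open>The downward direction implements the preference for large indices at the threshold
  key.\<close>

definition "select_row = Seq (Assign ''u'' (Var ''n''))
  (While (Less (Plus (Var ''v'') (Const 1)) (Var ''u'')) select_next)"

lemma idx_less: "i < n \<Longrightarrow> j < n \<Longrightarrow> i * n + j < n * n"
  using mult_le_mono1[of "Suc i" n n] by simp

lemma idx_eq: "j < n \<Longrightarrow> j' < n \<Longrightarrow> i * n + j = i' * n + j' \<longleftrightarrow> i = i' \<and> j = j'"
  by (metis mod_mult_self3 mod_less add_right_cancel mult_cancel2 less_nat_zero_code)

private abbreviation "S \<equiv> selected n m v r"

text \<open>The truncated subtraction is intended: the variable \<open>k\<close> is positive iff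
  fewer than the initial \<open>k\<close> vertices of key \<open>t\<close> have been met, which is
  the test in \<open>selected_threshold\<close>.\<close>

definition selecting :: "nat \<Rightarrow> nat \<Rightarrow> state \<Rightarrow> state \<Rightarrow> nat \<Rightarrow> bool" where
  "selecting t k s s' u \<longleftrightarrow> same_except {''u'', ''x'', ''k''} {''adj'', ''r''} s s' \<and>
    var s' ''k'' = k - card {i\<in>{u..<n}. K i = t} \<and>
    (\<forall>i<n. i \<noteq> v \<longrightarrow> arr s' ''r'' i = r i - of_bool (u \<le> i \<and> i \<in> S)) \<and>
    arr s' ''r'' v = r v - card {i\<in>S. u \<le> i} \<and>
    (\<forall>i<n. \<forall>j<n. arr s' ''adj'' (i * n + j) =
      (if i = v \<and> u \<le> j then of_bool (j \<in> S) else if j = v \<and> u \<le> i then of_bool (i \<in> S)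
       else arr s ''adj'' (i * n + j)))"

lemma select_next:
  assumes s: "row_vars s" "\<forall>i. v < i \<and> i < n \<longrightarrow> arr s ''key'' i = K i"
      "var s ''t'' = t" "threshold t k"
    and sel: "selecting t k s s' (Suc u)" and u: "v < u" "u < n" "var s' ''u'' = Suc u"
  shows "cfits W select_next s'" "selecting t k s (run select_next s') u"
    "var (run select_next s') ''u'' = u"
proof -
  from sel have same: "same_except {''u'', ''x'', ''k''} {''adj'', ''r''} s s'"
    and k: "var s' ''k'' = k - card {i\<in>{Suc u..<n}. K i = t}"
    and ri: "\<And>i. i < n \<Longrightarrow> i \<noteq> v \<Longrightarrow> arr s' ''r'' i = r i - of_bool (Suc u \<le> i \<and> i \<in> S)"
    and rv: "arr s' ''r'' v = r v - card {i\<in>S. Suc u \<le> i}"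
    and adj: "\<And>i j. i < n \<Longrightarrow> j < n \<Longrightarrow> arr s' ''adj'' (i * n + j) =
      (if i = v \<and> Suc u \<le> j then of_bool (j \<in> S) else if j = v \<and> Suc u \<le> i then of_bool (i \<in> S)
       else arr s ''adj'' (i * n + j))"
    by (auto simp: selecting_def)
  note eq = same_exceptD[OF same]
  have vars: "var s' ''n'' = n" "var s' ''v'' = v" "var s' ''t'' = t" "arr s' ''key'' u = K u"
    using s u by (auto simp: eq row_vars_def)
  have S: "u \<in> S \<longleftrightarrow> t < K u \<or> K u = t \<and> 0 < t \<and> 0 < var s' ''k''"
    using selected_threshold[of t r v n m k u] s(4) u k
    by (auto simp: threshold_def atLeastSucLessThan_greaterThanLessThan)
  have ru: "arr s' ''r'' u = r u" using ri[of u] u by simp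
  define k' where "k' = (if K u = t then var s' ''k'' - 1 else var s' ''k'')"
  let ?a = "arr s' ''adj''" and ?x = "of_bool (u \<in> S) :: nat"
  let ?s = "s'\<lparr>var := (var s')(''u'' := u, ''x'' := ?x, ''k'' := k'),
     arr := (arr s')(''adj'' := ?a(v * n + u := ?x, u * n + v := ?x),
       ''r'' := (arr s' ''r'')(u := r u - ?x, v := arr s' ''r'' v - ?x))\<rparr>"
  let ?s1 = "s'\<lparr>var := (var s')(''u'' := u)\<rparr>"
  have choose: "run choose_next ?s1 = s'\<lparr>var := (var s')(''u'' := u, ''x'' := ?x, ''k'' := k')\<rparr>"
    using S by (auto simp: choose_next_def vars k'_def simp del: fun_upd_triv)
  have run: "run select_next s' = ?s"
    using u by (simp add: select_next_def idx_def choose vars ru)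
  have "k \<le> r v" using s(4) by (auto simp: threshold_def)
  then have bounds: "var s' ''k'' < W" "arr s' ''r'' v < W" "r u < W" "K u < W" "t < W" "u < W" "n < W" "v < W"
    using W r[OF v] r[OF u(2)] u key_le[OF u(2)] k rv s(4) by (auto simp: threshold_def)
  have ix: "v * n + u < W" "u * n + v < W" "v * n < W" "u * n < W"
    using idx_less[of v u] idx_less[of u v] u W by linarith+
  have "cfits W choose_next ?s1"
    using bounds W by (simp add: choose_next_def vars)
  then show "cfits W select_next s'"
    using bounds ix u W by (simp add: select_next_def idx_def choose vars ru)
  have card: "{i\<in>{u..<n}. K i = t} = (if K u = t then insert u {i\<in>{Suc u..<n}. K i = t} else {i\<in>{Suc u..<n}. K i = t})"
    using u by (auto simp: Suc_le_eq order_le_less)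
  then have cardK: "card {i\<in>{u..<n}. K i = t} = card {i\<in>{Suc u..<n}. K i = t} + of_bool (K u = t)"
    by (simp only: card_insert_if finite_Collect_conjI finite_atLeastLessThan split: if_split) auto
  have cardS: "{i\<in>S. u \<le> i} = (if u \<in> S then insert u {i\<in>S. Suc u \<le> i} else {i\<in>S. Suc u \<le> i})"
    by (auto simp: Suc_le_eq order_le_less)
  have le: "u \<le> i \<longleftrightarrow> i = u \<or> Suc u \<le> i" for i by auto
  show "selecting t k s (run select_next s') u" unfolding run selecting_def
  proof (intro conjI allI impI)
    show "same_except {''u'', ''x'', ''k''} {''adj'', ''r''} s ?s" using same by (simp add: same_except_def)
    show "var ?s ''k'' = k - card {i\<in>{u..<n}. K i = t}"
      unfolding cardK by (simp add: k'_def k)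
    show "arr ?s ''r'' i = r i - of_bool (u \<le> i \<and> i \<in> S)" if "i < n" "i \<noteq> v" for i
      using that ri[OF that] by (auto simp: le)
    show "arr ?s ''r'' v = r v - card {i\<in>S. u \<le> i}"
      using finite_selected by (simp add: rv cardS)
    show "arr ?s ''adj'' (i * n + j) =
      (if i = v \<and> u \<le> j then of_bool (j \<in> S) else if j = v \<and> u \<le> i then of_bool (i \<in> S)
       else arr s ''adj'' (i * n + j))" if "i < n" "j < n" for i j
    proof -
      have upd: "arr ?s ''adj'' = ?a(v * n + u := ?x, u * n + v := ?x)" by simp
      have here: "arr ?s ''adj'' (i * n + j) =
          (if i = u \<and> j = v \<or> i = v \<and> j = u then ?x else arr s' ''adj'' (i * n + j))"
        unfolding upd fun_upd_apply idx_eq[OF that(2) u(2)] idx_eq[OF that(2) v] by argo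
      show ?thesis
      proof (cases "i = u \<and> j = v \<or> i = v \<and> j = u")
        case True
        then show ?thesis unfolding here using u(1) by auto
      next
        case False
        then have "i = v \<and> u \<le> j \<longleftrightarrow> i = v \<and> Suc u \<le> j" "j = v \<and> u \<le> i \<longleftrightarrow> j = v \<and> Suc u \<le> i"
          using u(1) by auto
        with False show ?thesis using here adj[OF that] by (simp only: if_False)
      qed
    qed
  qed
  show "var (run select_next s') ''u'' = u" by (simp add: run)
qed

lemma select_row:
  assumes s: "row_vars s" "\<forall>i<n. arr s ''r'' i = r i" "\<forall>i. v < i \<and> i < n \<longrightarrow> arr s ''key'' i = K i"
      "var s ''t'' = t" "var s ''k'' = k" "threshold t k" and T: "100 * (n + 1) \<le> T"
  shows "wp W select_row T (\<lambda>s'. selecting t k s s' (Suc v)) s"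
  unfolding select_row_def
proof (rule wp_seq[where R = "\<lambda>s'. same_except {''u''} {} s s' \<and> var s' ''u'' = n"
      and ?T1.0 = 2 and ?T2.0 = "(n + 1) * 90"])
  fix s1 assume s1: "same_except {''u''} {} s s1 \<and> var s1 ''u'' = n"
  let ?I = "\<lambda>s'. selecting t k s s' (var s' ''u'') \<and> v < var s' ''u'' \<and> var s' ''u'' \<le> n"
  show "wp W (While (Less (Plus (Var ''v'') (Const 1)) (Var ''u'')) select_next) ((n + 1) * 90)
    (\<lambda>s'. selecting t k s s' (Suc v)) s1"
  proof (rule wp_while[where I = ?I and f = "\<lambda>s'. var s' ''u''" and T = 80])
    have "{i\<in>S. n \<le> i} = {}" by (auto simp: selected_def)
    then have "card {i\<in>S. n \<le> i} = 0" by (simp only: card.empty)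
    then show "?I s1" using s1 s v
      by (auto simp: selecting_def same_except_def)
    fix s2 assume I: "?I s2"
    then have eq: "var s2 ''v'' = v"
      using s(1) by (auto simp: selecting_def same_except_def row_vars_def)
    show "bfits W (Less (Plus (Var ''v'') (Const 1)) (Var ''u'')) s2" using I v W by (simp add: eq)
    show "selecting t k s s2 (Suc v)" if "\<not> bval (Less (Plus (Var ''v'') (Const 1)) (Var ''u'')) s2"
    proof -
      have "var s2 ''u'' = Suc v" using I that by (simp add: eq)
      with I show ?thesis by simp
    qed
    assume b: "bval (Less (Plus (Var ''v'') (Const 1)) (Var ''u'')) s2"
    obtain u where u: "var s2 ''u'' = Suc u" "v < u" "u < n"
      using I b by (cases "var s2 ''u''") (auto simp: eq)
    note step = select_next[OF s(1,3,4,6) _ u(2,3,1)]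
    show "wp W select_next 80 (\<lambda>s'. ?I s' \<and> var s' ''u'' < var s2 ''u'') s2"
      using step I u by (intro wp_run) (auto simp: select_next_def choose_next_def idx_def simp del: run.simps cfits.simps)
  qed (use s1 in auto)
qed (use s v W T in \<open>auto intro!: wp_run simp: same_except_def row_vars_def\<close>)

text \<open>Only raises the flag. From \<open>v = m\<close> on, every pair has been tested at its
  smaller member.\<close>

definition "finish_row = Seq
  (Cond (Less (Const 0) (Elem ''r'' (Var ''v''))) (Assign ''bad'' (Const 1)) Skip)
  (Seq (Cond (Less (Var ''v'') (Var ''m''))
    (Cond (Eq (Elem ''adj'' (Plus (Times (Var ''v'') (Var ''n''))
        (Minus (Minus (Times (Const 2) (Var ''m'')) (Const 1)) (Var ''v'')))) (Const 0))
      (Assign ''bad'' (Const 1)) Skip) Skip)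
  (Assign ''v'' (Plus (Var ''v'') (Const 1))))"

definition "write_row = Seq clear_counts (Seq store_keys (Seq find_threshold (Seq select_row finish_row)))"

definition row_written :: "state \<Rightarrow> state \<Rightarrow> bool" where
  "row_written s s' \<longleftrightarrow>
    same_except {''u'', ''x'', ''k'', ''t'', ''bad'', ''v''} {''key'', ''cnt'', ''adj'', ''r''} s s' \<and>
    var s' ''v'' = Suc v \<and> (\<forall>i<n. arr s' ''r'' i = residual n m v r i) \<and>
    (\<forall>i<n. \<forall>j<n. arr s' ''adj'' (i * n + j) =
      (if i = v \<and> v < j then of_bool (j \<in> S) else if j = v \<and> v < i then of_bool (i \<in> S)
       else arr s ''adj'' (i * n + j))) \<and>
    var s' ''bad'' = (if 0 < residual n m v r v \<or> v < m \<and> arr s' ''adj'' (v * n + (2 * m - 1 - v)) = 0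
      then 1 else var s ''bad'')"

lemma finish_row:
  assumes s: "row_vars s" and s': "same_except {''u'', ''x'', ''k'', ''t''} {''key'', ''cnt''} s s'"
    and sel: "selecting t k s' s'' (Suc v)" and T: "40 \<le> T"
  shows "wp W finish_row T (row_written s) s''"
proof -
  let ?X = "{''u'', ''x'', ''k'', ''t'', ''bad'', ''v''}" and ?Y = "{''key'', ''cnt'', ''adj'', ''r''}"
  have s'': "same_except {''u'', ''x'', ''k''} {''adj'', ''r''} s' s''"
    and ri: "\<And>i. i < n \<Longrightarrow> i \<noteq> v \<Longrightarrow> arr s'' ''r'' i = r i - of_bool (Suc v \<le> i \<and> i \<in> S)"
    and rv: "arr s'' ''r'' v = r v - card {i\<in>S. Suc v \<le> i}"
    and adj: "\<And>i j. i < n \<Longrightarrow> j < n \<Longrightarrow> arr s'' ''adj'' (i * n + j) =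
      (if i = v \<and> Suc v \<le> j then of_bool (j \<in> S) else if j = v \<and> Suc v \<le> i then of_bool (i \<in> S)
       else arr s' ''adj'' (i * n + j))"
    using sel by (auto simp: selecting_def)
  have same: "same_except ?X ?Y s s''"
    using same_except_trans[OF s' s''] by simp
  have vars: "var s'' ''n'' = n" "var s'' ''m'' = m" "var s'' ''v'' = v" "var s'' ''bad'' = var s ''bad''"
    using s s' s'' by (auto simp: row_vars_def same_except_def)
  have S: "{i\<in>S. Suc v \<le> i} = S" "\<And>i. i \<in> S \<Longrightarrow> Suc v \<le> i" by (auto simp: selected_def)
  have r': "\<And>i. i < n \<Longrightarrow> arr s'' ''r'' i = residual n m v r i"
    using ri rv S by (auto simp: residual_def)
  have rvv: "arr s'' ''r'' v = residual n m v r v" using r' v by blast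
  have "residual n m v r v \<le> r v" by (simp add: residual_def)
  then have rW: "residual n m v r v < W" using r[OF v] W by linarith
  have adj': "arr s'' ''adj'' (i * n + j) =
      (if i = v \<and> v < j then of_bool (j \<in> S) else if j = v \<and> v < i then of_bool (i \<in> S)
       else arr s ''adj'' (i * n + j))" if "i < n" "j < n" for i j
    using adj[OF that] same_exceptD(2)[OF s'] by (simp add: Suc_le_eq)
  define a where "a = arr s'' ''adj'' (v * n + (2 * m - 1 - v))"
  have aW: "a < W" "v * n + (2 * m - 1 - v) < W" if "v < m"
  proof -
    have p: "2 * m - 1 - v < n" "v < 2 * m - 1 - v" using that m by auto
    show "a < W" unfolding a_def adj'[OF v p(1)] using p W by auto
    show "v * n + (2 * m - 1 - v) < W" using idx_less[OF v p(1)] W by linarith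
  qed
  have vn: "v * n < W" using idx_less[OF v v] W by linarith
  define b where "b = (if 0 < residual n m v r v \<or> v < m \<and> a = 0 then 1 else var s'' ''bad'')"
  have run: "run finish_row s'' = s''\<lparr>var := (var s'')(''bad'' := b, ''v'' := Suc v)\<rparr>"
    using a_def[symmetric] by (auto simp: finish_row_def vars rvv b_def simp del: fun_upd_triv)
      (auto simp: fun_upd_idem_iff fun_upd_twist vars intro!: arg_cong[where f = "\<lambda>g. s''\<lparr>var := g\<rparr>"] ext)
  have fits: "cfits W finish_row s''"
    using v m W rW aW vn by (auto simp: finish_row_def vars rvv a_def)
  have bad: "b = (if 0 < residual n m v r v \<or> v < m \<and> arr s'' ''adj'' (v * n + (2 * m - 1 - v)) = 0
      then 1 else var s ''bad'')"
    unfolding b_def a_def vars(4) ..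
  have "row_written s (run finish_row s'')"
    unfolding run row_written_def
  proof (intro conjI)
    show "same_except ?X ?Y s (s''\<lparr>var := (var s'')(''bad'' := b, ''v'' := Suc v)\<rparr>)"
      using same by (simp add: same_except_def)
  qed (use r' adj' bad in \<open>simp_all only: state.simps fun_upd_apply char.inject list.inject simp_thms if_True if_False\<close>, auto)
  moreover have "loop_free finish_row" "ccost finish_row \<le> T" using T by (simp_all add: finish_row_def)
  ultimately show ?thesis by (intro wp_run fits)
qed

text \<open>The stages contribute 32 + 80 + 60 + 100 + 40 = 312 times \<open>n + 1\<close>.\<close>

lemma write_row:
  assumes s: "row_vars s" "\<forall>i<n. arr s ''r'' i = r i" and T: "320 * (n + 1) \<le> T"
  shows "wp W write_row T (row_written s) s"
  unfolding write_row_def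
proof (rule wp_seq[OF clear_counts[of s n W "32 * (n + 1)"]])
  let ?X = "{''u'', ''x'', ''k'', ''t''}" and ?Y = "{''key'', ''cnt''}"
  have keep: "row_vars s'" "\<forall>i<n. arr s' ''r'' i = r i" if "same_except ?X ?Y s s'" for s'
    using that s by (auto simp: same_except_def row_vars_def)
  fix s1 assume s1: "same_except {''u''} {''cnt''} s s1 \<and> (\<forall>i\<le>2*n. arr s1 ''cnt'' i = 0)"
  have same1: "same_except ?X ?Y s s1"
    using same_except_trans[OF same_except_refl[of "{}" "{}"] conjunct1[OF s1]] by simp
  show "wp W (Seq store_keys (Seq find_threshold (Seq select_row finish_row))) (280 * (n + 1)) (row_written s) s1"
  proof (rule wp_seq[OF store_keys[OF keep[OF same1] conjunct2[OF s1], of "80 * (n + 1)"]])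
    fix s2 assume s2: "same_except {''u'', ''x''} ?Y s1 s2 \<and>
      (\<forall>i. v < i \<and> i < n \<longrightarrow> arr s2 ''key'' i = K i) \<and>
      (\<forall>t\<le>2*n. arr s2 ''cnt'' t = card {i\<in>{v<..<n}. K i = t})"
    have same2: "same_except ?X ?Y s s2"
      using same_except_trans[OF same1 conjunct1[OF s2]] by simp
    show "wp W (Seq find_threshold (Seq select_row finish_row)) (200 * (n + 1)) (row_written s) s2"
    proof (rule wp_seq[OF find_threshold[OF keep[OF same2] conjunct2[OF conjunct2[OF s2]], of "60 * (n + 1)"]])
      fix s3 assume s3: "same_except {''t'', ''k''} {} s2 s3 \<and> threshold (var s3 ''t'') (var s3 ''k'')"
      have same3: "same_except ?X ?Y s s3"
        using same_except_trans[OF same2 conjunct1[OF s3]] by simp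
      have key: "\<forall>i. v < i \<and> i < n \<longrightarrow> arr s3 ''key'' i = K i"
        using s2 same_exceptD(2)[OF conjunct1[OF s3]] by simp
      show "wp W (Seq select_row finish_row) (140 * (n + 1)) (row_written s) s3"
        by (rule wp_seq[OF select_row[OF keep[OF same3] key refl refl conjunct2[OF s3], of "100 * (n + 1)"]
              finish_row[OF s(1) same3]]) auto
    qed auto
  qed auto
qed (use s W T in \<open>auto simp: row_vars_def\<close>)

end

section \<open>The run for a fixed \<open>m\<close>, and the search for the largest feasible
  \<open>m\<close>\<close>

definition "attempt = Seq (Assign ''bad'' (Const 0)) (Seq copy_degrees (Seq (Assign ''v'' (Const 0))
  (While (Less (Var ''v'') (Var ''n'')) write_row)))"

text \<open>\<open>m\<close> starts one too large because the loop decrements it before each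
  run.\<close>

definition "maximize_matching = Seq (Assign ''m'' (Plus (Div (Var ''n'') (Const 2)) (Const 1)))
  (Seq (Assign ''bad'' (Const 1))
  (While (Less (Const 0) (Var ''bad'')) (Seq (Assign ''m'' (Minus (Var ''m'') (Const 1))) attempt)))"

lemma rows_done_le: "rows_done n m v d r A bad \<Longrightarrow> i < n \<Longrightarrow> r i \<le> d i"
  unfolding rows_done_def by (metis le_add1)

context
  fixes d :: "nat list" and n W :: nat
  assumes sorted: "sorted_wrt (\<ge>) d" and n: "n = length d" and small: "\<forall>i<n. d ! i < n"
    and W: "n * n + 4 * n + 10 \<le> W"
begin

definition adj_of :: "state \<Rightarrow> nat \<Rightarrow> nat \<Rightarrow> nat" where
  "adj_of s i j = arr s ''adj'' (i * n + j)"

text \<open>What persists between runs. Off the diagonal the matrix is unconstrained, since a run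
  overwrites all of these entries.\<close>

definition ready :: "state \<Rightarrow> bool" where
  "ready s \<longleftrightarrow> var s ''n'' = n \<and> (\<forall>i<n. arr s ''d'' i = d ! i) \<and> (\<forall>i<n. adj_of s i i = 0) \<and>
    var s ''bad'' \<le> 1"

definition attempting :: "nat \<Rightarrow> state \<Rightarrow> bool" where
  "attempting m s \<longleftrightarrow> ready s \<and> var s ''m'' = m \<and> var s ''v'' \<le> n \<and>
    (\<exists>r. (\<forall>i<n. arr s ''r'' i = r i) \<and> rows_done n m (var s ''v'') ((!) d) r (adj_of s) (var s ''bad''))"

lemma write_row_attempting:
  assumes att: "attempting m s" and v: "var s ''v'' < n" and m: "2 * m \<le> n" and T: "320 * (n + 1) \<le> T"
  shows "wp W write_row T (\<lambda>s'. attempting m s' \<and> n - var s' ''v'' < n - var s ''v'') s"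
proof -
  let ?v = "var s ''v''"
  obtain r where r: "\<forall>i<n. arr s ''r'' i = r i" "rows_done n m ?v ((!) d) r (adj_of s) (var s ''bad'')"
    and s: "ready s" "var s ''m'' = m" using att by (auto simp: attempting_def)
  have rn: "\<forall>i<n. r i < n"
    using rows_done_le[OF r(2)] small by (meson le_less_trans)
  have "row_vars n m ?v s" using s unfolding row_vars_def[OF v m W rn] by (simp add: ready_def)
  note wr = write_row[OF v m W rn this r(1) T]
  show ?thesis
  proof (rule wp_mono[OF wr order_refl])
    fix s' assume "row_written n m ?v r s s'"
    then have same: "same_except {''u'', ''x'', ''k'', ''t'', ''bad'', ''v''} {''key'', ''cnt'', ''adj'', ''r''} s s'"
      and v': "var s' ''v'' = Suc ?v" and r': "\<forall>i<n. arr s' ''r'' i = residual n m ?v r i"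
      and adj: "\<And>i j. i < n \<Longrightarrow> j < n \<Longrightarrow> adj_of s' i j =
        (if i = ?v \<and> ?v < j then of_bool (j \<in> selected n m ?v r)
         else if j = ?v \<and> ?v < i then of_bool (i \<in> selected n m ?v r) else adj_of s i j)"
      and bad: "var s' ''bad'' = (if 0 < residual n m ?v r ?v \<or>
        ?v < m \<and> adj_of s' ?v (2 * m - 1 - ?v) = 0 then 1 else var s ''bad'')"
      unfolding row_written_def[OF v m W rn] adj_of_def by simp_all
    have "adj_of s' i i = 0" if "i < n" for i
      using adj[OF that that] s(1) that by (auto simp: ready_def)
    then have "ready s'" using s(1) same bad by (auto simp: ready_def same_except_def)
    moreover have "adj_of s ?v ?v = 0" using s(1) v by (simp add: ready_def)
    from rows_done_step[OF r(2) v m small this adj bad]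
    have "rows_done n m (var s' ''v'') ((!) d) (residual n m ?v r) (adj_of s') (var s' ''bad'')"
      unfolding v' .
    moreover have "var s' ''m'' = m" using s same by (simp add: same_except_def)
    ultimately show "attempting m s' \<and> n - var s' ''v'' < n - ?v"
      using r' v v' unfolding attempting_def by auto
  qed
qed

lemma attempt:
  assumes s: "ready s" "var s ''m'' = m" and m: "2 * m \<le> n" and T: "400 * ((n + 1) * (n + 1)) \<le> T"
  shows "wp W attempt T (\<lambda>s'. ready s' \<and> var s' ''m'' = m \<and>
    (\<exists>r. rows_done n m n ((!) d) r (adj_of s') (var s' ''bad''))) s"
  unfolding attempt_def
proof (rule wp_seq[where R = "\<lambda>s'. ready s' \<and> var s' ''m'' = m \<and> var s' ''bad'' = 0"
      and ?T1.0 = 2 and ?T2.0 = "16 * (n + 1) + 324 * ((n + 1) * (n + 1))"])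
  show "wp W (Assign ''bad'' (Const 0)) 2 (\<lambda>s'. ready s' \<and> var s' ''m'' = m \<and> var s' ''bad'' = 0) s"
    using s W by (intro wp_run) (auto simp: ready_def adj_of_def)
  fix s1 assume s1: "ready s1 \<and> var s1 ''m'' = m \<and> var s1 ''bad'' = 0"
  have "arr s1 ''d'' i < W" if "i < n" for i
    using s1 that small[rule_format, OF that] W by (simp add: ready_def)
  note copy = copy_degrees[OF _ this _ order_refl]
  show "wp W (Seq copy_degrees (Seq (Assign ''v'' (Const 0)) (While (Less (Var ''v'') (Var ''n'')) write_row)))
    (16 * (n + 1) + 324 * ((n + 1) * (n + 1))) (\<lambda>s'. ready s' \<and> var s' ''m'' = m \<and>
    (\<exists>r. rows_done n m n ((!) d) r (adj_of s') (var s' ''bad''))) s1"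
  proof (rule wp_seq[OF copy])
    show "var s1 ''n'' = n" "n + 1 < W" using s1 W by (auto simp: ready_def)
    fix s2 assume "same_except {''u''} {''r''} s1 s2 \<and> (\<forall>i<n. arr s2 ''r'' i = arr s1 ''d'' i)"
    then have s2: "ready s2" "var s2 ''m'' = m" "var s2 ''bad'' = 0" "\<forall>i<n. arr s2 ''r'' i = d ! i"
      using s1 by (auto simp: ready_def adj_of_def same_except_def)
    show "wp W (Seq (Assign ''v'' (Const 0)) (While (Less (Var ''v'') (Var ''n'')) write_row))
      (2 + 324 * ((n + 1) * (n + 1))) (\<lambda>s'. ready s' \<and> var s' ''m'' = m \<and>
      (\<exists>r. rows_done n m n ((!) d) r (adj_of s') (var s' ''bad''))) s2"
    proof (rule wp_seq[where R = "attempting m" and ?T1.0 = 2 and ?T2.0 = "324 * ((n + 1) * (n + 1))"])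
      have "rows_done n m 0 ((!) d) ((!) d) (adj_of s2) 0"
        unfolding n using rows_done_init[OF sorted] m n by simp
      then show "wp W (Assign ''v'' (Const 0)) 2 (attempting m) s2"
        using s2 W by (intro wp_run) (auto simp: attempting_def ready_def adj_of_def[abs_def])
      fix s3 assume s3: "attempting m s3"
      show "wp W (While (Less (Var ''v'') (Var ''n'')) write_row) (324 * ((n + 1) * (n + 1)))
        (\<lambda>s'. ready s' \<and> var s' ''m'' = m \<and>
        (\<exists>r. rows_done n m n ((!) d) r (adj_of s') (var s' ''bad''))) s3"
      proof (rule wp_while[where I = "attempting m" and f = "\<lambda>s. n - var s ''v''" and T = "320 * (n + 1)"])
        fix s4 assume s4: "attempting m s4"
        then have *: "var s4 ''n'' = n" "var s4 ''v'' \<le> n" by (auto simp: attempting_def ready_def)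
        then show "bfits W (Less (Var ''v'') (Var ''n'')) s4" using W by simp
        show "ready s4 \<and> var s4 ''m'' = m \<and> (\<exists>r. rows_done n m n ((!) d) r (adj_of s4) (var s4 ''bad''))"
          if "\<not> bval (Less (Var ''v'') (Var ''n'')) s4"
        proof -
          have "var s4 ''v'' = n" using * that by simp
          then show ?thesis using s4 by (auto simp: attempting_def)
        qed
        assume "bval (Less (Var ''v'') (Var ''n'')) s4"
        then show "wp W write_row (320 * (n + 1)) (\<lambda>s'. attempting m s' \<and> n - var s' ''v'' < n - var s4 ''v'') s4"
          using * by (intro write_row_attempting[OF s4 _ m]) auto
      next
        have "(n - var s3 ''v'' + 1) * (4 + 320 * (n + 1)) \<le> (n + 1) * (324 * (n + 1))"
          by (intro mult_mono) auto
        then show "(n - var s3 ''v'' + 1) * (bcost (Less (Var ''v'') (Var ''n'')) + 1 + 320 * (n + 1))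
          \<le> 324 * ((n + 1) * (n + 1))" by (simp add: algebra_simps)
      qed (fact s3)
    qed simp
  qed (auto simp: algebra_simps)
next
  define N where "N = (n + 1) * (n + 1)"
  have "n + 1 \<le> N" by (simp add: N_def)
  then show "2 + (16 * (n + 1) + 324 * ((n + 1) * (n + 1))) \<le> T" using T unfolding N_def[symmetric] by simp
qed

lemma maximize_matching:
  assumes graphic: "realizes d E0" and s: "ready s" and T: "1300 * ((n + 1) * ((n + 1) * (n + 1))) \<le> T"
  shows "wp W maximize_matching T (\<lambda>s'. \<exists>E M. realizes d E \<and> matching E M \<and> card M = MM d \<and>
    (\<forall>i<n. \<forall>j<n. adj_of s' i j = of_bool ({i, j} \<in> E))) s"
proof -
  let ?N = "(n + 1) * (n + 1)"
  let ?Q = "\<lambda>s'. \<exists>E M. realizes d E \<and> matching E M \<and> card M = MM d \<and>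
    (\<forall>i<n. \<forall>j<n. adj_of s' i j = of_bool ({i, j} \<in> E))"
  let ?loop = "While (Less (Const 0) (Var ''bad'')) (Seq (Assign ''m'' (Minus (Var ''m'') (Const 1))) attempt)"
  let ?f = "\<lambda>s'. if var s' ''bad'' = 0 then 0 else var s' ''m'' + 1"
  define I where "I s' \<longleftrightarrow> ready s' \<and> var s' ''m'' \<le> n div 2 + 1 \<and>
    (\<forall>k. var s' ''m'' < k \<or> var s' ''bad'' \<noteq> 0 \<and> k = var s' ''m'' \<longrightarrow> \<not> feasible n k 0 ((!) d)) \<and>
    (var s' ''bad'' = 0 \<longrightarrow> (\<exists>r. rows_done n (var s' ''m'') n ((!) d) r (adj_of s') 0) \<and> 2 * var s' ''m'' \<le> n)" for s'
  obtain E1 M1 where opt: "realizes d E1" "matching E1 M1" "card M1 = MM d"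
    and max: "\<And>E M. realizes d E \<Longrightarrow> matching E M \<Longrightarrow> card M \<le> MM d"
    using MM_attained[OF graphic] by metis
  have feas: "feasible n (card M) 0 ((!) d)" if "realizes d E" "matching E M" for E M
    unfolding n using feasible_of_matching[OF sorted that] .
  \<comment> \<open>The empty matching shows that \<open>m = 0\<close> is feasible, so the search
    succeeds there at the latest and never decrements 0.\<close>
  have "feasible n (card ({} :: nat set set)) 0 ((!) d)"
    by (rule feas[OF graphic]) (simp add: matching_def)
  then have feas0: "feasible n 0 0 ((!) d)" by simp
  \<comment> \<open>For such \<open>k\<close> the mate \<open>2 * k - 1\<close> of vertex 0 would
    lie outside the graph.\<close>
  have large: "\<not> feasible n k 0 ((!) d)" if "n div 2 + 1 \<le> k" for k
  proof
    assume f: "feasible n k 0 ((!) d)"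
    have "0 < k" using that by simp
    from feasible_pos(3)[OF f this] that show False by simp
  qed
  have exit: "?Q s'" if I: "I s'" and b: "\<not> bval (Less (Const 0) (Var ''bad'')) s'" for s'
  proof -
    have bad: "var s' ''bad'' = 0" using b by simp
    then obtain r where rd: "rows_done n (var s' ''m'') n ((!) d) r (adj_of s') 0" "2 * var s' ''m'' \<le> n"
      using I unfolding I_def by blast
    from rows_done_final(2)[OF rd[unfolded n] refl] obtain E M where
      E: "realizes d E" "matching E M" "card M = var s' ''m''"
      "\<forall>i<n. \<forall>j<n. adj_of s' i j = of_bool ({i, j} \<in> E)" unfolding n by blast
    have "\<not> var s' ''m'' < MM d" using feas[OF opt(1,2)] opt(3) I unfolding I_def by auto
    with max[OF E(1,2)] E(3) have "card M = MM d" by simp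
    with E show ?thesis by blast
  qed
  have step: "wp W (Seq (Assign ''m'' (Minus (Var ''m'') (Const 1))) attempt) (4 + 400 * ?N)
      (\<lambda>s''. I s'' \<and> ?f s'' < ?f s') s'" if I: "I s'" and b: "bval (Less (Const 0) (Var ''bad'')) s'" for s'
  proof -
    have bad: "var s' ''bad'' \<noteq> 0" using b by simp
    have "\<not> feasible n (var s' ''m'') 0 ((!) d)" using I bad unfolding I_def by blast
    with feas0 have "var s' ''m'' \<noteq> 0" by (intro notI) simp
    then obtain m where m: "var s' ''m'' = Suc m" by (cases "var s' ''m''") auto
    have mn: "m \<le> n div 2" "2 * m \<le> n" using I m unfolding I_def by auto
    have no: "\<not> feasible n k 0 ((!) d)" if "m < k" for k
      using I bad m that unfolding I_def by (cases "k = Suc m") auto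
    show ?thesis
    proof (rule wp_seq[where R = "\<lambda>s''. ready s'' \<and> var s'' ''m'' = m" and ?T1.0 = 4 and ?T2.0 = "400 * ?N"])
      show "wp W (Assign ''m'' (Minus (Var ''m'') (Const 1))) 4 (\<lambda>s''. ready s'' \<and> var s'' ''m'' = m) s'"
        using I m mn W unfolding I_def by (intro wp_run) (auto simp: ready_def adj_of_def)
      fix s1 assume s1: "ready s1 \<and> var s1 ''m'' = m"
      show "wp W attempt (400 * ?N) (\<lambda>s''. I s'' \<and> ?f s'' < ?f s') s1"
      proof (rule wp_mono[OF attempt[OF conjunct1[OF s1] conjunct2[OF s1] mn(2) order_refl] order_refl])
        fix s2 assume s2: "ready s2 \<and> var s2 ''m'' = m \<and> (\<exists>r. rows_done n m n ((!) d) r (adj_of s2) (var s2 ''bad''))"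
        then obtain r where r: "rows_done n m n ((!) d) r (adj_of s2) (var s2 ''bad'')" by blast
        have "\<not> feasible n m 0 ((!) d)" if "var s2 ''bad'' \<noteq> 0"
          using rows_done_final(1)[OF r[unfolded n] mn(2)[unfolded n]] that unfolding n by blast
        then show "I s2 \<and> ?f s2 < ?f s'"
          using s2 r no mn bad m unfolding I_def by auto
      qed
    qed simp
  qed
  show ?thesis unfolding maximize_matching_def
  proof (rule wp_seq[where R = "\<lambda>s'. ready s' \<and> var s' ''m'' = n div 2 + 1" and ?T1.0 = 6
        and ?T2.0 = "2 + (n div 2 + 3) * (8 + 400 * ?N)"])
    show "wp W (Assign ''m'' (Plus (Div (Var ''n'') (Const 2)) (Const 1))) 6
      (\<lambda>s'. ready s' \<and> var s' ''m'' = n div 2 + 1) s"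
      using s W by (intro wp_run) (auto simp: ready_def adj_of_def)
    fix s1 assume s1: "ready s1 \<and> var s1 ''m'' = n div 2 + 1"
    show "wp W (Seq (Assign ''bad'' (Const 1)) ?loop) (2 + (n div 2 + 3) * (8 + 400 * ?N)) ?Q s1"
    proof (rule wp_seq[where R = "\<lambda>s'. I s' \<and> var s' ''m'' = n div 2 + 1" and ?T1.0 = 2
        and ?T2.0 = "(n div 2 + 3) * (8 + 400 * ?N)"])
      show "wp W (Assign ''bad'' (Const 1)) 2 (\<lambda>s'. I s' \<and> var s' ''m'' = n div 2 + 1) s1"
        using s1 large W by (intro wp_run) (auto simp: I_def ready_def adj_of_def)
      fix s2 assume s2: "I s2 \<and> var s2 ''m'' = n div 2 + 1"
      show "wp W ?loop ((n div 2 + 3) * (8 + 400 * ?N)) ?Q s2"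
      proof (rule wp_while[where I = I and f = ?f and T = "4 + 400 * ?N"])
        show "I s2" using s2 by simp
        show "bfits W (Less (Const 0) (Var ''bad'')) s'" if "I s'" for s'
          using that W by (auto simp: I_def ready_def)
        \<comment> \<open>As \<open>m\<close> starts at \<open>n div 2 + 1\<close>, the variant is
          at most \<open>n div 2 + 2\<close>.\<close>
        have "(?f s2 + 1) * (8 + 400 * ?N) \<le> (n div 2 + 3) * (8 + 400 * ?N)"
          using s2 by (intro mult_right_mono) auto
        then show "(?f s2 + 1) * (bcost (Less (Const 0) (Var ''bad'')) + 1 + (4 + 400 * ?N))
          \<le> (n div 2 + 3) * (8 + 400 * ?N)" by simp
      qed (use step exit in blast)+
    qed simp
  next
    have "(n div 2 + 3) * (8 + 400 * ?N) \<le> (3 * (n + 1)) * (408 * ?N)" by (intro mult_mono) auto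
    also have "\<dots> = 1224 * ((n + 1) * ?N)" by (simp add: algebra_simps)
    finally have "(n div 2 + 3) * (8 + 400 * ?N) \<le> 1224 * ((n + 1) * ?N)" .
    moreover have "1 \<le> (n + 1) * ?N" by simp
    ultimately show "6 + (2 + (n div 2 + 3) * (8 + 400 * ?N)) \<le> T" using T by linarith
  qed
qed

end

theorem theorem4:
  "\<exists>(P :: com) (k :: nat) (T :: nat \<Rightarrow> nat).
     (\<lambda>n. real (T n)) \<in> O(\<lambda>n. real n ^ 3) \<and>
     (\<forall>d. graphic d \<longrightarrow>
       (\<exists>t s E. exec ((length d + 2) ^ k) P (input_state d) t s \<and>
                t \<le> T (length d) \<and>
                outputs_graph (length d) s E \<and>
                realizes d E \<and>
                (\<exists>M. matching E M \<and> card M = MM d)))"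
proof (rule exI[of _ maximize_matching], rule exI[of _ 4],
    rule exI[of _ "\<lambda>n. 1300 * ((n + 1) * ((n + 1) * (n + 1)))"], rule conjI[OF _ allI[OF impI]])
  let ?T = "\<lambda>n. 1300 * ((n + 1) * ((n + 1) * (n + 1))) :: nat"
  show "(\<lambda>n. real (?T n)) \<in> O(\<lambda>n. real n ^ 3)"
  \<comment> \<open>The factor 8 stems from \<open>n + 1 <= 2 * n\<close> for
    \<open>n >= 1\<close>.\<close>
  proof (rule bigoI[where c = "1300 * 8"])
    have "real (?T n) \<le> 1300 * 8 * real n ^ 3" if "1 \<le> n" for n
    proof -
      have "real (n + 1) ^ 3 \<le> (2 * real n) ^ 3" using that by (intro power_mono) auto
      moreover have "real (?T n) = 1300 * real (n + 1) ^ 3"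
        unfolding of_nat_mult power3_eq_cube by simp
      moreover have "(2 * real n) ^ 3 = 8 * real n ^ 3" by (simp add: power_mult_distrib)
      ultimately show ?thesis by linarith
    qed
    then show "\<forall>\<^sub>F n in sequentially. norm (real (?T n)) \<le> 1300 * 8 * norm (real n ^ 3)"
      by (intro eventually_sequentiallyI[of 1]) auto
  qed
  fix d assume "graphic d"
  then obtain E0 where sorted: "sorted_wrt (\<ge>) d" and E0: "realizes d E0" by (auto simp: graphic_def)
  let ?n = "length d"
  \<comment> \<open>Degrees in a simple graph are below the number of vertices; the dominance of the
    mate's key \<open>2 * n\<close> rests on this.\<close>
  have small: "\<forall>i<?n. d ! i < ?n"
  proof (intro allI impI)
    fix i assume i: "i < ?n"
    have g: "graph_on {..<?n} E0" using E0 by (simp add: realizes_graph_on)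
    have "d ! i = card (nbrs E0 i)" using E0 i degree_eq_card_nbrs[OF g] by (simp add: realizes_graph_on)
    also have "\<dots> \<le> card ({..<?n} - {i})" using nbrs_subset[OF g] by (intro card_mono) auto
    also have "\<dots> < ?n" using i by simp
    finally show "d ! i < ?n" .
  qed
  \<comment> \<open>The exponent 4 is dictated by \<open>n = 0\<close>, where exponent 3 would give
    only 8 against the required 10.\<close>
  have W: "?n * ?n + 4 * ?n + 10 \<le> (?n + 2) ^ 4"
  proof -
    have "4 * ((?n + 2) * (?n + 2)) \<le> (?n + 2) * (?n + 2) * ((?n + 2) * (?n + 2))"
      by (intro mult_right_mono) auto
    then show ?thesis by (simp add: algebra_simps power4_eq_xxxx)
  qed
  note ctx = sorted refl small W
  have "ready d ?n (input_state d)"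
    unfolding ready_def[OF ctx] adj_of_def[OF ctx] by (simp add: input_state_def)
  from maximize_matching[OF ctx E0 this order_refl] obtain t s E M where
    "exec ((?n + 2) ^ 4) maximize_matching (input_state d) t s" "t \<le> ?T ?n"
    "realizes d E" "matching E M" "card M = MM d"
    "\<forall>i<?n. \<forall>j<?n. adj_of ?n s i j = of_bool ({i, j} \<in> E)"
    unfolding wp_def by blast
  then show "\<exists>t s E. exec ((length d + 2) ^ 4) maximize_matching (input_state d) t s \<and>
      t \<le> ?T (length d) \<and> outputs_graph (length d) s E \<and> realizes d E \<and>
      (\<exists>M. matching E M \<and> card M = MM d)"
    unfolding adj_of_def[OF ctx] outputs_graph_def by (intro exI[of _ t] exI[of _ s] exI[of _ E]) auto
qed

end
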